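(* Let $\alpha\in(0,1)$ and let $p_\alpha(t,x)$, $t,x>0$, be the positive stable semigroup defined below. For every integer $n\ge 2$, the kernel $(t,x)\mapsto p_\alpha(t,x)$ on $(0,\infty)\times(0,\infty)$ is ${\rm TP}_n$ if and only if $\alpha\in\{1/2,1/3,\ldots,1/n\}$ or $\alpha<1/n$.
   Context: For $\alpha\in(0,1)$, the positive stable semigroup is the family of probability densities $x\mapsto p_\alpha(t,x)$ on $(0,\infty)$, $t>0$, characterized by $\int_0^\infty p_\alpha(t,x)e^{-\lambda x}\,dx=e^{-t\lambda^\alpha}$ for all $t,\lambda>0$. A real kernel $K$ on $I\times J$ ($I,J$ real intervals) is ${\rm TP}_n$ (totally positive of order $n$) if $\det[K(x_i,y_j)]_{1\le i,j\le m}\ge 0$ for every $m\in\{1,\ldots,n\}$, all $x_1<\cdots<x_m$ in $I$ and all $y_1<\cdots<y_m$ in $J$. *)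

theory Defs
  imports "HOL-Analysis.Analysis" "Jordan_Normal_Form.Determinant"
begin

definition TP :: "nat \<Rightarrow> real set \<Rightarrow> real set \<Rightarrow> (real \<Rightarrow> real \<Rightarrow> real) \<Rightarrow> bool" where
  "TP n I J K \<longleftrightarrow>
     (\<forall>m xs ys. 1 \<le> m \<and> m \<le> n \<and>
        (\<forall>i<m. xs i \<in> I \<and> ys i \<in> J) \<and>
        (\<forall>i j. i < j \<and> j < m \<longrightarrow> xs i < xs j \<and> ys i < ys j)
      \<longrightarrow> Determinant.det (mat m m (\<lambda>(i,j). K (xs i) (ys j))) \<ge> 0)"

definition stable_semigroup :: "real \<Rightarrow> (real \<Rightarrow> real \<Rightarrow> real) \<Rightarrow> bool" where
  "stable_semigroup \<alpha> p \<longleftrightarrow>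
     (\<forall>t>0. continuous_on {0<..} (p t) \<and> (\<forall>x>0. p t x \<ge> 0) \<and>
        set_integrable lborel {0<..} (p t) \<and>
        (LINT x:{0<..}|lborel. p t x) = 1 \<and>
        (\<forall>s>0. set_integrable lborel {0<..} (\<lambda>x. p t x * exp (-s * x)) \<and>
                (LINT x:{0<..}|lborel. p t x * exp (-s * x)) = exp (-t * s powr \<alpha>)))"

end

(* With a = 1/\<alpha>, comparing Laplace transforms gives
     x p(t,x) = C t \<integral>\<^sub>t\<^sup>\<infinity> (v - t)^(a-2) p(v,x) dv.
   The kernel max(v - t, 0)^c is TP\<^sub>n if c > n - 2 or c is a natural number. Iterating the identity k times, starting
   from the Laplace transform exp(-t \<lambda>\<^sup>\<alpha>), the composition formula (Andreief) makes the k-th derivatives of the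
   Laplace transform TP\<^sub>n in (t, 1/\<lambda>), and Post-Widder inversion carries this over to p.
   Conversely, if p is TP\<^sub>n then so is the second derivative of its Laplace transform, which up to factors and
   reparametrisation is exp(-t/x) (a - 1 + t/x). Its minors of order m as t \<rightarrow> 0 have the sign of
   \<Prod>\<^sub>k\<^sub><\<^sub>m (a - 1 - k), which is negative for m - 1 < a < m. *)
theory Submission
  imports Defs "HOL-Probability.Distributions"
begin

section \<open>Determinants of kernels\<close>

text \<open>The identity expresses \<open>p\<close> at time t through \<open>p\<close> at later
  times, so by itself it does not carry total positivity from a known kernel over to
  \<open>p\<close>. On the Laplace side it does: it maps each derivative to the next one, and the
  zeroth is explicit. Working there also avoids Fubini for \<open>p\<close>, whose joint
  measurability in (t,x) is not part of \<open>stable_semigroup\<close>: the identity is checked for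
  the first derivative, where it is a Gamma integral, and is then differentiated in the Laplace
  variable. The exponent a - 2 exceeds n - 2 exactly when \<alpha> < 1/n, and it is natural exactly
  when 1/\<alpha> is an integer; this is where the shape of the parameter set comes from. In the
  converse the second derivative is the lowest useful one: the first is exp(-t \<lambda>^\<alpha>)
  times positive factors in t alone and in \<lambda> alone, so it is totally positive for every
  \<alpha>.\<close>

definition kdet :: "nat \<Rightarrow> (nat \<Rightarrow> nat \<Rightarrow> real) \<Rightarrow> real" where
  "kdet m F = Determinant.det (mat m m (\<lambda>(i,j). F i j))"

lemma permutes_lt: "\<sigma> permutes {0..<m} \<Longrightarrow> i < m \<Longrightarrow> \<sigma> i < m" for i m :: nat
  using permutes_in_image[of \<sigma> "{0..<m}" i] by simp

lemma kdet_leibniz: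
  "kdet m F = (\<Sum>\<sigma> | \<sigma> permutes {0..<m}. of_int (sign \<sigma>) * (\<Prod>i=0..<m. F i (\<sigma> i)))"
  unfolding kdet_def
  by (subst det_def'[where n = m]) (auto intro!: sum.cong prod.cong simp: permutes_in_image)

lemma kdet_cong:
  assumes "\<And>i j. i < m \<Longrightarrow> j < m \<Longrightarrow> F i j = G i j"
  shows "kdet m F = kdet m G"
  unfolding kdet_leibniz using assms by (auto intro!: sum.cong prod.cong simp: permutes_in_image)

lemma kdet_swap: "kdet m (\<lambda>i j. F j i) = kdet m F"
proof -
  have "mat m m (\<lambda>(i,j). F j i) = transpose_mat (mat m m (\<lambda>(i,j). F i j))"
    by (rule eq_matI) auto
  thus ?thesis unfolding kdet_def by (metis det_transpose mat_carrier)
qed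

lemma kdet_permute:
  assumes "\<pi> permutes {0..<m}"
  shows "kdet m (\<lambda>i. F (\<pi> i)) = of_int (sign \<pi>) * kdet m F"
proof -
  have *: "mat m m (\<lambda>(i,j). F (\<pi> i) j) = mat m m (\<lambda>(i,j). mat m m (\<lambda>(i,j). F i j) $$ (\<pi> i, j))"
    using assms by (intro eq_matI) (auto simp: permutes_lt)
  show ?thesis unfolding kdet_def *
    by (rule det_permute_rows) (use assms in auto)
qed

lemma kdet_rows_scale: "kdet m (\<lambda>i j. c i * F i j) = (\<Prod>i<m. c i) * kdet m F"
  unfolding kdet_leibniz
  by (simp add: prod.distrib sum_distrib_left mult_ac lessThan_atLeast0)

lemma kdet_cols_scale: "kdet m (\<lambda>i j. c j * F i j) = (\<Prod>i<m. c i) * kdet m F"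
  by (metis (no_types) kdet_rows_scale[of m c "\<lambda>i j. F j i"] kdet_swap[of m F] kdet_swap[of m "\<lambda>i j. c j * F i j"])

lemma kdet_zero_row:
  assumes "i < m" "\<And>j. j < m \<Longrightarrow> F i j = 0"
  shows "kdet m F = 0"
proof -
  have "(\<Prod>k=0..<m. F k (\<sigma> k)) = 0" if "\<sigma> permutes {0..<m}" for \<sigma>
  proof (rule prod_zero)
    show "\<exists>a\<in>{0..<m}. F a (\<sigma> a) = 0"
      using assms that by (intro bexI[of _ i]) (auto simp: permutes_lt)
  qed auto
  thus ?thesis unfolding kdet_leibniz by (intro sum.neutral) auto
qed

lemma kdet_zero_col:
  assumes "j < m" "\<And>i. i < m \<Longrightarrow> F i j = 0"
  shows "kdet m F = 0"
  using kdet_zero_row[of j m "\<lambda>i j. F j i"] assms unfolding kdet_swap[of m F] by blast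

lemma kdet_equal_rows:
  assumes "i < m" "k < m" "i \<noteq> k" "\<And>j. j < m \<Longrightarrow> F i j = F k j"
  shows "kdet m F = 0"
  unfolding kdet_def
  by (rule det_identical_rows[of _ m i k]) (use assms in auto)

lemma kdet_first_col_unit:
  assumes "\<And>i. i < m \<Longrightarrow> F (Suc i) 0 = 0"
  shows "kdet (Suc m) F = F 0 0 * kdet m (\<lambda>i j. F (Suc i) (Suc j))"
proof -
  let ?A = "mat (Suc m) (Suc m) (\<lambda>(i,j). F i j)"
  have del: "mat_delete ?A 0 0 = mat m m (\<lambda>(i,j). F (Suc i) (Suc j))"
    by (rule eq_matI) (auto simp: mat_delete_def)
  have "kdet (Suc m) F = (\<Sum>i<Suc m. ?A $$ (i,0) * cofactor ?A i 0)"
    unfolding kdet_def by (rule laplace_expansion_column) auto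
  also have "\<dots> = ?A $$ (0,0) * cofactor ?A 0 0"
    by (subst sum.lessThan_Suc_shift) (use assms in simp)
  finally show ?thesis by (simp add: cofactor_def del kdet_def)
qed

lemma kdet_first_row_unit:
  assumes "\<And>j. j < m \<Longrightarrow> F 0 (Suc j) = 0"
  shows "kdet (Suc m) F = F 0 0 * kdet m (\<lambda>i j. F (Suc i) (Suc j))"
  using kdet_first_col_unit[of m "\<lambda>i j. F j i"] assms
  unfolding kdet_swap[of _ F] kdet_swap[of _ "\<lambda>i j. F (Suc i) (Suc j)"] by blast

lemma kdet_mult:
  "kdet m (\<lambda>i j. \<Sum>k<m. F i k * G k j) = kdet m F * kdet m G"
proof -
  have "mat m m (\<lambda>(i,j). \<Sum>k<m. F i k * G k j) = mat m m (\<lambda>(i,j). F i j) * mat m m (\<lambda>(i,j). G i j)"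
    by (rule eq_matI) (auto simp: scalar_prod_def lessThan_atLeast0)
  thus ?thesis unfolding kdet_def by (metis det_mult mat_carrier)
qed

lemma kdet_upper_triangular:
  assumes "\<And>i j. j < i \<Longrightarrow> i < m \<Longrightarrow> F i j = 0"
  shows "kdet m F = (\<Prod>i<m. F i i)"
proof -
  have "upper_triangular (mat m m (\<lambda>(i,j). F i j))"
    using assms by (auto simp: upper_triangular_def)
  hence "kdet m F = prod_list (diag_mat (mat m m (\<lambda>(i,j). F i j)))"
    unfolding kdet_def by (rule det_upper_triangular) auto
  also have "diag_mat (mat m m (\<lambda>(i,j). F i j)) = map (\<lambda>i. F i i) [0..<m]"
    by (auto simp: diag_mat_def)
  also have "prod_list \<dots> = (\<Prod>i<m. F i i)"
    using prod.distinct_set_conv_list[of "[0..<m]" "\<lambda>i. F i i"] by (simp add: lessThan_atLeast0)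
  finally show ?thesis .
qed

text \<open>Right multiplication by a unipotent bidiagonal matrix. All columns change at once, each
  using its original predecessor, and the multiplier may vary with the column.\<close>

lemma kdet_subtract_prev_col:
  "kdet m (\<lambda>i j. F i j - (if j = 0 then 0 else c j * F i (j - 1))) = kdet m F"
proof -
  define U :: "nat \<Rightarrow> nat \<Rightarrow> real" where
    "U = (\<lambda>k j. if k = j then 1 else if Suc k = j then - c j else 0)"
  have "kdet m U = 1"
    by (subst kdet_upper_triangular) (auto simp: U_def)
  moreover have "(\<Sum>k<m. F i k * U k j) = F i j - (if j = 0 then 0 else c j * F i (j - 1))" 
    if "j < m" for i j
  proof -
    have "(\<Sum>k<m. F i k * U k j) = (\<Sum>k<m. (if k = j then F i k else 0) + (if k = j - 1 \<and> j \<noteq> 0 then - c j * F i k else 0))"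
      by (intro sum.cong) (auto simp: U_def)
    also have "\<dots> = F i j + (\<Sum>k<m. (if k = j - 1 \<and> j \<noteq> 0 then - c j * F i k else 0))"
      using that by (simp add: sum.distrib)
    also have "\<dots> = F i j - (if j = 0 then 0 else c j * F i (j - 1))"
      using that by (cases "j = 0") auto
    finally show ?thesis .
  qed
  ultimately show ?thesis
    using kdet_mult[of m F U] by (metis (no_types, lifting) kdet_cong mult.right_neutral)
qed

text \<open>Differences of consecutive columns annihilate row 0 except for its leading 1.\<close>

lemma kdet_first_row_ones:
  assumes "\<And>j. j < Suc m \<Longrightarrow> F 0 j = 1"
  shows "kdet (Suc m) F = kdet m (\<lambda>i j. F (Suc i) (Suc j) - F (Suc i) j)"
proof -
  have "kdet (Suc m) F = kdet (Suc m) (\<lambda>i j. F i j - (if j = 0 then 0 else 1 * F i (j - 1)))"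
    by (rule kdet_subtract_prev_col[symmetric])
  also have "\<dots> = kdet m (\<lambda>i j. F (Suc i) (Suc j) - F (Suc i) j)"
    by (subst kdet_first_row_unit) (use assms in auto)
  finally show ?thesis .
qed

lemma tendsto_kdet:
  assumes "\<And>i j. i < m \<Longrightarrow> j < m \<Longrightarrow> ((\<lambda>k. F k i j) \<longlongrightarrow> G i j) A"
  shows "((\<lambda>k. kdet m (F k)) \<longlongrightarrow> kdet m G) A"
  unfolding kdet_leibniz
  by (intro tendsto_intros assms) (auto simp: permutes_lt)

text \<open>Subtracting \<open>x 0\<close> times the preceding column reduces row 0 to its leading 1
  and pulls a factor \<open>x i - x 0 > 0\<close> out of every other row, leaving a smaller
  Vandermonde matrix.\<close>

lemma vandermonde_pos:
  fixes x :: "nat \<Rightarrow> real"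
  assumes "\<And>i j. i < j \<Longrightarrow> j < m \<Longrightarrow> x i < x j"
  shows "kdet m (\<lambda>i j. x i ^ j) > 0"
  using assms
proof (induction m arbitrary: x)
  case 0
  show ?case by (simp add: kdet_leibniz)
next
  case (Suc m)
  have "kdet (Suc m) (\<lambda>i j. x i ^ j) =
      kdet (Suc m) (\<lambda>i j. x i ^ j - (if j = 0 then 0 else x 0 * x i ^ (j - 1)))"
    by (rule kdet_subtract_prev_col[symmetric])
  also have "\<dots> = kdet m (\<lambda>i j. (x (Suc i) - x 0) * x (Suc i) ^ j)"
    by (subst kdet_first_row_unit) (auto simp: algebra_simps)
  also have "\<dots> = (\<Prod>i<m. x (Suc i) - x 0) * kdet m (\<lambda>i j. x (Suc i) ^ j)"
    by (rule kdet_rows_scale)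
  also have "\<dots> > 0"
    using Suc.prems by (intro mult_pos_pos prod_pos Suc.IH) auto
  finally show ?case .
qed

section \<open>Determinants of integrals and Andreief's composition formula\<close>

lemma kdet_integral:
  fixes h :: "nat \<Rightarrow> nat \<Rightarrow> real \<Rightarrow> real"
  assumes "\<And>i j. i < m \<Longrightarrow> j < m \<Longrightarrow> integrable lborel (\<lambda>x. h i j x)"
  shows "integrable (Pi\<^sub>M {0..<m} (\<lambda>_. lborel)) (\<lambda>x. kdet m (\<lambda>i j. h i j (x i)))"
    and "kdet m (\<lambda>i j. LINT x|lborel. h i j x)
      = (LINT x|Pi\<^sub>M {0..<m} (\<lambda>_. lborel). kdet m (\<lambda>i j. h i j (x i)))"
proof -
  interpret product_sigma_finite "\<lambda>_::nat. lborel :: real measure"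
    by (simp add: product_sigma_finite_def sigma_finite_lborel)
  \<comment> \<open>Each row gets its own integration variable, so a Leibniz term is a product of
    functions of separate variables and its integral factorises.\<close>
  have *: "integrable (Pi\<^sub>M {0..<m} (\<lambda>_. lborel)) (\<lambda>x. (\<Prod>i=0..<m. h i (\<sigma> i) (x i)))"
    "(LINT x|Pi\<^sub>M {0..<m} (\<lambda>_. lborel). (\<Prod>i=0..<m. h i (\<sigma> i) (x i))) = (\<Prod>i=0..<m. LINT x|lborel. h i (\<sigma> i) x)"
    if "\<sigma> permutes {0..<m}" for \<sigma>
  proof -
    have *: "integrable lborel (h i (\<sigma> i))" if "i \<in> {0..<m}" for i
      using assms[of i "\<sigma> i"] permutes_lt[OF \<open>\<sigma> permutes {0..<m}\<close>] that by simp
    show "integrable (Pi\<^sub>M {0..<m} (\<lambda>_. lborel)) (\<lambda>x. (\<Prod>i=0..<m. h i (\<sigma> i) (x i)))"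
      by (intro product_integrable_prod *) auto
    show "(LINT x|Pi\<^sub>M {0..<m} (\<lambda>_. lborel). (\<Prod>i=0..<m. h i (\<sigma> i) (x i))) = (\<Prod>i=0..<m. LINT x|lborel. h i (\<sigma> i) x)"
      by (intro product_integral_prod *) auto
  qed
  show "integrable (Pi\<^sub>M {0..<m} (\<lambda>_. lborel)) (\<lambda>x. kdet m (\<lambda>i j. h i j (x i)))"
    unfolding kdet_leibniz using * by (intro Bochner_Integration.integrable_sum integrable_mult_right) auto
  show "kdet m (\<lambda>i j. LINT x|lborel. h i j x)
      = (LINT x|Pi\<^sub>M {0..<m} (\<lambda>_. lborel). kdet m (\<lambda>i j. h i j (x i)))"
    unfolding kdet_leibniz using *
    by (subst Bochner_Integration.integral_sum) (auto intro!: sum.cong integrable_mult_right)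
qed

lemma exists_sorting_permutation:
  fixes x :: "nat \<Rightarrow> real"
  assumes "inj_on x {0..<m}"
  obtains \<pi> where "\<pi> permutes {0..<m}" "\<And>i j. i < j \<Longrightarrow> j < m \<Longrightarrow> x (\<pi> i) < x (\<pi> j)"
proof -
  define xs where "xs = map x [0..<m]"
  have "mset (sort xs) = mset xs" by simp
  then obtain \<pi> where \<pi>: "\<pi> permutes {..<length xs}" "permute_list \<pi> xs = sort xs"
    by (rule mset_eq_permutation)
  have len: "length xs = m" by (simp add: xs_def)
  have nth: "sort xs ! i = x (\<pi> i)" if "i < m" for i
    using \<pi> that permute_list_nth[OF \<pi>(1), of i] permutes_in_image[OF \<pi>(1), of i]
    by (auto simp: len xs_def)
  have d: "distinct (sort xs)" using assms by (simp add: xs_def distinct_map)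
  have "x (\<pi> i) < x (\<pi> j)" if "i < j" "j < m" for i j
  proof -
    have "sort xs ! i \<le> sort xs ! j"
      using that by (intro sorted_nth_mono) (auto simp: len)
    moreover have "sort xs ! i \<noteq> sort xs ! j"
      using d that by (simp add: nth_eq_iff_index_eq len)
    ultimately show ?thesis using nth that by simp
  qed
  with \<pi>(1) show thesis by (intro that[of \<pi>]) (simp_all add: len lessThan_atLeast0)
qed

text \<open>The continuous Cauchy-Binet formula. The determinant is replaced by the sum over all row
  permutations, each term carrying its sign; this accounts for \<open>fact m\<close>. After
  \<open>kdet_integral\<close> the row factors \<open>f (\<pi> i) (x i)\<close> come out of each
  term, and summing them over \<pi> is the Leibniz expansion of the first determinant.\<close>

lemma andreief:
  fixes f g :: "nat \<Rightarrow> real \<Rightarrow> real"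
  assumes int: "\<And>i j. i < m \<Longrightarrow> j < m \<Longrightarrow> integrable lborel (\<lambda>x. f i x * g j x)"
  shows "fact m * kdet m (\<lambda>i j. LINT x|lborel. f i x * g j x)
    = (LINT x|Pi\<^sub>M {0..<m} (\<lambda>_. lborel). kdet m (\<lambda>i j. f i (x j)) * kdet m (\<lambda>i j. g i (x j)))"
proof -
  let ?P = "{\<pi>. \<pi> permutes {0..<m}}"
  let ?M = "Pi\<^sub>M {0..<m} (\<lambda>_. lborel :: real measure)"
  let ?A = "\<lambda>i j. LINT x|lborel. f i x * g j x"
  let ?h = "\<lambda>\<pi> x. of_int (sign \<pi>) * kdet m (\<lambda>i j. f (\<pi> i) (x i) * g j (x i))"
  have h: "of_int (sign \<pi>) * kdet m (\<lambda>i. ?A (\<pi> i)) = (LINT x|?M. ?h \<pi> x)"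
    "integrable ?M (?h \<pi>)" if "\<pi> \<in> ?P" for \<pi>
    using that kdet_integral[of m "\<lambda>i j x. f (\<pi> i) x * g j x"] int by (auto simp: permutes_lt)
  have fin: "finite ?P" by (simp add: finite_permutations)
  have sgn: "of_int (sign \<pi>) * of_int (sign \<pi>) = (1::real)" for \<pi> :: "nat \<Rightarrow> nat"
    by (simp add: sign_def)
  have "fact m * kdet m ?A = (\<Sum>\<pi>\<in>?P. of_int (sign \<pi>) * kdet m (\<lambda>i. ?A (\<pi> i)))"
    by (simp add: kdet_permute[where F = ?A] mult.assoc[symmetric] sgn card_permutations[of "{0..<m}" m])
  also have "\<dots> = (LINT x|?M. (\<Sum>\<pi>\<in>?P. ?h \<pi> x))"
    using h by (subst Bochner_Integration.integral_sum) auto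
  also have "(\<lambda>x. \<Sum>\<pi>\<in>?P. ?h \<pi> x) = (\<lambda>x. kdet m (\<lambda>i j. f i (x j)) * kdet m (\<lambda>i j. g i (x j)))"
  proof
    fix x
    have "?h \<pi> x = (of_int (sign \<pi>) * (\<Prod>i=0..<m. f (\<pi> i) (x i))) * kdet m (\<lambda>i j. g j (x i))" for \<pi>
      by (simp add: kdet_rows_scale lessThan_atLeast0)
    hence "(\<Sum>\<pi>\<in>?P. ?h \<pi> x) = kdet m (\<lambda>i j. f j (x i)) * kdet m (\<lambda>i j. g j (x i))"
      unfolding kdet_leibniz[of m "\<lambda>i j. f j (x i)"] sum_distrib_right by (intro sum.cong) auto
    thus "(\<Sum>\<pi>\<in>?P. ?h \<pi> x) = kdet m (\<lambda>i j. f i (x j)) * kdet m (\<lambda>i j. g i (x j))"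
      unfolding kdet_swap[of m "\<lambda>i j. f i (x j)"] kdet_swap[of m "\<lambda>i j. g i (x j)"] .
  qed
  finally show ?thesis .
qed

text \<open>Sorting the points multiplies both determinants by the same sign, which cancels in the
  product, so increasing points suffice. Coinciding points give equal columns, and a point outside
  \<open>S\<close> gives a zero column of the first determinant.\<close>

lemma andreief_nonneg:
  fixes f g :: "nat \<Rightarrow> real \<Rightarrow> real"
  assumes int: "\<And>i j. i < m \<Longrightarrow> j < m \<Longrightarrow> integrable lborel (\<lambda>x. f i x * g j x)"
    and supp: "\<And>i x. x \<notin> S \<Longrightarrow> f i x = 0"
    and f: "\<And>x. (\<And>i j. i < j \<Longrightarrow> j < m \<Longrightarrow> x i < x j) \<Longrightarrow> (\<And>i. i < m \<Longrightarrow> x i \<in> S) \<Longrightarrow> kdet m (\<lambda>i j. f i (x j)) \<ge> 0"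
    and g: "\<And>x. (\<And>i j. i < j \<Longrightarrow> j < m \<Longrightarrow> x i < x j) \<Longrightarrow> (\<And>i. i < m \<Longrightarrow> x i \<in> S) \<Longrightarrow> kdet m (\<lambda>i j. g i (x j)) \<ge> 0"
  shows "kdet m (\<lambda>i j. LINT x|lborel. f i x * g j x) \<ge> 0"
proof -
  have "kdet m (\<lambda>i j. f i (x j)) * kdet m (\<lambda>i j. g i (x j)) \<ge> 0" for x
  proof (cases "inj_on x {0..<m} \<and> (\<forall>i<m. x i \<in> S)")
    case True
    then obtain \<pi> where \<pi>: "\<pi> permutes {0..<m}" "\<And>i j. i < j \<Longrightarrow> j < m \<Longrightarrow> x (\<pi> i) < x (\<pi> j)"
      using exists_sorting_permutation by blast
    have perm: "kdet m (\<lambda>i j. h i (x (\<pi> j))) = of_int (sign \<pi>) * kdet m (\<lambda>i j. h i (x j))" for h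
      using kdet_permute[OF \<pi>(1), of "\<lambda>i j. h j (x i)"]
      unfolding kdet_swap[of m "\<lambda>i j. h i (x (\<pi> j))"] kdet_swap[of m "\<lambda>i j. h i (x j)"] .
    have "kdet m (\<lambda>i j. f i (x (\<pi> j))) * kdet m (\<lambda>i j. g i (x (\<pi> j))) \<ge> 0"
      using \<pi> True by (intro mult_nonneg_nonneg f g) (auto simp: permutes_lt)
    thus ?thesis unfolding perm by (auto simp: sign_def split: if_splits)
  next
    case False
    have "kdet m (\<lambda>i j. f i (x j)) = 0"
    proof (cases "inj_on x {0..<m}")
      case True
      thus ?thesis using False kdet_zero_col[where F = "\<lambda>i j. f i (x j)"] supp by blast
    next
      case False
      then obtain i k where "i < m" "k < m" "i \<noteq> k" "x i = x k" by (auto simp: inj_on_def)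
      thus ?thesis using kdet_equal_rows[of i m k "\<lambda>i j. f j (x i)"]
        unfolding kdet_swap[of m "\<lambda>i j. f i (x j)"] by simp
    qed
    thus ?thesis by simp
  qed
  hence "fact m * kdet m (\<lambda>i j. LINT x|lborel. f i x * g j x) \<ge> 0"
    by (subst andreief[OF int]) (auto intro!: integral_nonneg_AE)
  thus ?thesis using fact_gt_zero[of m, where ?'a = real] by (auto simp: zero_le_mult_iff not_le[symmetric])
qed

text \<open>Passes from gauge integrals, as produced by the fundamental theorem of calculus and by
  Euler's Gamma integral, to Lebesgue integrals; for nonnegative functions the two agree.\<close>

lemma nonneg_has_integral_lborel:
  fixes f :: "real \<Rightarrow> real"
  assumes [measurable]: "f \<in> borel_measurable borel" "S \<in> sets borel"
    and nonneg: "\<And>x. x \<in> S \<Longrightarrow> f x \<ge> 0" and I: "(f has_integral I) S"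
  shows "set_integrable lborel S f" "(LINT x:S|lborel. f x) = I"
proof -
  have "I \<ge> 0" using has_integral_nonneg[OF I] nonneg by auto
  have nn: "(\<integral>\<^sup>+x. ennreal (indicator S x * f x) \<partial>lborel) = ennreal I"
    by (rule nn_integral_has_integral_lebesgue[OF nonneg I])
  have *: "(\<lambda>x. indicator S x * f x) \<in> borel_measurable lborel" "AE x in lborel. 0 \<le> indicator S x * f x"
    using nonneg by (auto simp: indicator_def)
  have "integrable lborel (\<lambda>x. indicator S x * f x)"
    using * nn by (intro integrableI_nonneg) auto
  thus "set_integrable lborel S f" by (simp add: set_integrable_def)
  show "(LINT x:S|lborel. f x) = I"
    using integral_eq_nn_integral[OF *] nn \<open>I \<ge> 0\<close> by (simp add: set_lebesgue_integral_def)
qed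

section \<open>Closure properties of total positivity\<close>

lemma TP_kdet:
  "TP n I J K \<longleftrightarrow> (\<forall>m xs ys. 1 \<le> m \<and> m \<le> n \<and> (\<forall>i<m. xs i \<in> I \<and> ys i \<in> J) \<and>
     (\<forall>i j. i < j \<and> j < m \<longrightarrow> xs i < xs j \<and> ys i < ys j) \<longrightarrow> kdet m (\<lambda>i j. K (xs i) (ys j)) \<ge> 0)"
  unfolding TP_def kdet_def ..

lemma TP_I:
  assumes "\<And>m xs ys. 1 \<le> m \<Longrightarrow> m \<le> n \<Longrightarrow> (\<And>i. i < m \<Longrightarrow> xs i \<in> I) \<Longrightarrow> (\<And>i. i < m \<Longrightarrow> ys i \<in> J) \<Longrightarrow>
    (\<And>i j. i < j \<Longrightarrow> j < m \<Longrightarrow> xs i < xs j) \<Longrightarrow> (\<And>i j. i < j \<Longrightarrow> j < m \<Longrightarrow> ys i < ys j) \<Longrightarrow>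
    kdet m (\<lambda>i j. K (xs i) (ys j)) \<ge> 0"
  shows "TP n I J K"
  unfolding TP_kdet using assms by blast

lemma TP_D:
  assumes "TP n I J K" "m \<le> n" "\<And>i. i < m \<Longrightarrow> xs i \<in> I" "\<And>i. i < m \<Longrightarrow> ys i \<in> J"
    "\<And>i j. i < j \<Longrightarrow> j < m \<Longrightarrow> xs i < xs j" "\<And>i j. i < j \<Longrightarrow> j < m \<Longrightarrow> ys i < ys j"
  shows "kdet m (\<lambda>i j. K (xs i) (ys j)) \<ge> 0"
proof (cases "m = 0")
  case True
  thus ?thesis by (simp add: kdet_leibniz)
next
  case False
  thus ?thesis using assms unfolding TP_kdet by simp
qed

lemma TP_reparam:
  assumes "TP n I J K" "\<And>x. x \<in> I' \<Longrightarrow> f x \<in> I" "\<And>x. x \<in> J' \<Longrightarrow> g x \<in> J"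
    "strict_mono_on I' f" "strict_mono_on J' g"
  shows "TP n I' J' (\<lambda>x y. K (f x) (g y))"
proof (rule TP_I)
  fix m and xs ys :: "nat \<Rightarrow> real"
  assume m: "m \<le> n" and xs: "\<And>i. i < m \<Longrightarrow> xs i \<in> I'" "\<And>i j. i < j \<Longrightarrow> j < m \<Longrightarrow> xs i < xs j"
    and ys: "\<And>i. i < m \<Longrightarrow> ys i \<in> J'" "\<And>i j. i < j \<Longrightarrow> j < m \<Longrightarrow> ys i < ys j"
  show "kdet m (\<lambda>i j. K (f (xs i)) (g (ys j))) \<ge> 0"
  proof (rule TP_D[OF assms(1) m])
    fix i j assume "i < j" "j < m"
    thus "f (xs i) < f (xs j)" "g (ys i) < g (ys j)"
      using xs ys by (auto intro!: strict_mono_onD[OF assms(4)] strict_mono_onD[OF assms(5)])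
  qed (use assms xs ys in auto)
qed

lemma TP_scale:
  assumes "TP n I J K" "\<And>x. x \<in> I \<Longrightarrow> a x \<ge> 0" "\<And>y. y \<in> J \<Longrightarrow> b y \<ge> 0"
  shows "TP n I J (\<lambda>x y. a x * b y * K x y)"
proof (rule TP_I)
  fix m and xs ys :: "nat \<Rightarrow> real"
  assume m: "m \<le> n" and xs: "\<And>i. i < m \<Longrightarrow> xs i \<in> I" "\<And>i j. i < j \<Longrightarrow> j < m \<Longrightarrow> xs i < xs j"
    and ys: "\<And>i. i < m \<Longrightarrow> ys i \<in> J" "\<And>i j. i < j \<Longrightarrow> j < m \<Longrightarrow> ys i < ys j"
  have "kdet m (\<lambda>i j. a (xs i) * (b (ys j) * K (xs i) (ys j))) =
      (\<Prod>i<m. a (xs i)) * ((\<Prod>j<m. b (ys j)) * kdet m (\<lambda>i j. K (xs i) (ys j)))"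
    by (simp add: kdet_rows_scale kdet_cols_scale)
  also have "\<dots> \<ge> 0"
    by (intro mult_nonneg_nonneg prod_nonneg TP_D[OF assms(1) m]) (use assms xs ys in auto)
  finally show "kdet m (\<lambda>i j. a (xs i) * b (ys j) * K (xs i) (ys j)) \<ge> 0" by (simp add: mult.assoc)
qed

lemma TP_cong:
  assumes "\<And>x y. x \<in> I \<Longrightarrow> y \<in> J \<Longrightarrow> K x y = L x y"
  shows "TP n I J K \<longleftrightarrow> TP n I J L"
proof -
  have *: "kdet m (\<lambda>i j. K (xs i) (ys j)) = kdet m (\<lambda>i j. L (xs i) (ys j))" 
    if "\<forall>i<m. xs i \<in> I \<and> ys i \<in> J" for m xs ys
    using that assms by (intro kdet_cong) auto
  show ?thesis unfolding TP_kdet using * by (simp cong: conj_cong)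
qed

lemma TP_limit:
  assumes "\<And>k::nat. TP n I J (K k)" "\<And>x y. x \<in> I \<Longrightarrow> y \<in> J \<Longrightarrow> (\<lambda>k. K k x y) \<longlonglongrightarrow> L x y"
  shows "TP n I J L"
proof (rule TP_I)
  fix m and xs ys :: "nat \<Rightarrow> real"
  assume m: "m \<le> n" and xs: "\<And>i. i < m \<Longrightarrow> xs i \<in> I" "\<And>i j. i < j \<Longrightarrow> j < m \<Longrightarrow> xs i < xs j"
    and ys: "\<And>i. i < m \<Longrightarrow> ys i \<in> J" "\<And>i j. i < j \<Longrightarrow> j < m \<Longrightarrow> ys i < ys j"
  show "kdet m (\<lambda>i j. L (xs i) (ys j)) \<ge> 0"
  proof (rule LIMSEQ_le_const)
    show "(\<lambda>k. kdet m (\<lambda>i j. K k (xs i) (ys j))) \<longlonglongrightarrow> kdet m (\<lambda>i j. L (xs i) (ys j))"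
      by (intro tendsto_kdet assms xs ys)
    show "\<exists>N. \<forall>k\<ge>N. 0 \<le> kdet m (\<lambda>i j. K k (xs i) (ys j))"
      using TP_D[OF assms(1) m] xs ys by blast
  qed
qed

lemma TP_compose:
  assumes K: "TP n I S K" and L: "TP n S J L"
    and int: "\<And>x y. x \<in> I \<Longrightarrow> y \<in> J \<Longrightarrow> set_integrable lborel S (\<lambda>z. K x z * L z y)"
  shows "TP n I J (\<lambda>x y. LINT z:S|lborel. K x z * L z y)"
proof (rule TP_I)
  fix m and xs ys :: "nat \<Rightarrow> real"
  assume m: "m \<le> n" and xs: "\<And>i. i < m \<Longrightarrow> xs i \<in> I" "\<And>i j. i < j \<Longrightarrow> j < m \<Longrightarrow> xs i < xs j"
    and ys: "\<And>i. i < m \<Longrightarrow> ys i \<in> J" "\<And>i j. i < j \<Longrightarrow> j < m \<Longrightarrow> ys i < ys j"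
  \<comment> \<open>The indicator is attached to \<open>K\<close>, so that a point outside
    \<open>S\<close> kills a whole column of the first determinant.\<close>
  have "kdet m (\<lambda>i j. LINT z|lborel. (indicator S z * K (xs i) z) * L z (ys j)) \<ge> 0"
  proof (rule andreief_nonneg[where S = S])
    fix i j assume "i < m" "j < m"
    thus "integrable lborel (\<lambda>z. (indicator S z * K (xs i) z) * L z (ys j))"
      using int[OF xs(1) ys(1)] by (simp add: set_integrable_def mult.assoc)
  next
    fix z :: "nat \<Rightarrow> real" assume z: "\<And>i j. i < j \<Longrightarrow> j < m \<Longrightarrow> z i < z j" "\<And>i. i < m \<Longrightarrow> z i \<in> S"
    have "kdet m (\<lambda>i j. indicator S (z j) * K (xs i) (z j)) = kdet m (\<lambda>i j. K (xs i) (z j))"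
      using z by (intro kdet_cong) auto
    also have "\<dots> \<ge> 0" by (intro TP_D[OF K m] xs z)
    finally show "kdet m (\<lambda>i j. indicator S (z j) * K (xs i) (z j)) \<ge> 0" .
    have "kdet m (\<lambda>i j. L (z j) (ys i)) = kdet m (\<lambda>i j. L (z i) (ys j))"
      by (rule kdet_swap)
    also have "\<dots> \<ge> 0" by (intro TP_D[OF L m] ys z)
    finally show "kdet m (\<lambda>i j. L (z j) (ys i)) \<ge> 0" .
  qed auto
  thus "kdet m (\<lambda>i j. LINT z:S|lborel. K (xs i) z * L z (ys j)) \<ge> 0"
    by (simp add: set_lebesgue_integral_def mult.assoc)
qed

section \<open>Truncated powers\<close>

text \<open>The kernel of fractional integration, up to a Gamma factor. Its value at 0 is 0 for
  every exponent: \<open>tpow 0\<close> is the indicator of the open half-line, and negative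
  exponents have no infinite value at their singularity.\<close>

definition tpow :: "real \<Rightarrow> real \<Rightarrow> real" where
  "tpow c x = (if 0 < x then x powr c else 0)"

lemma Nats_diff_one:
  fixes c :: real
  assumes "c \<in> \<nat>" "c > 0" shows "c - 1 \<in> \<nat>"
proof -
  obtain k where k: "c = real k" using assms(1) by (auto elim: Nats_cases)
  hence "c - 1 = real (k - 1)" using assms(2) by (simp add: of_nat_diff)
  thus ?thesis by simp
qed

lemma tpow_nonneg [simp]: "tpow c x \<ge> 0"
  by (simp add: tpow_def)

lemma tpow_measurable [measurable]: "tpow c \<in> borel_measurable borel"
  unfolding tpow_def by measurable

lemma tpow_mult:
  assumes "a > 0" shows "tpow c (a * x) = a powr c * tpow c x"
  using assms by (auto simp: tpow_def powr_mult zero_less_mult_iff)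

lemma isCont_tpow:
  assumes "c > 0" shows "isCont (tpow c) x"
proof -
  have "tpow c = (\<lambda>x. max 0 x powr c)"
    using assms by (auto simp: tpow_def fun_eq_iff max_def)
  moreover have "isCont (\<lambda>x. max 0 x powr c) x"
    using assms by (intro continuous_within_tendsto_compose' continuous_intros) 
       (auto simp: isCont_def intro!: tendsto_powr' tendsto_intros eventuallyI)
  ultimately show ?thesis by simp
qed

lemma tpow_deriv:
  assumes "x \<noteq> 0"
  shows "(tpow c has_real_derivative c * tpow (c - 1) x) (at x)"
proof (cases "x > 0")
  case True
  have "((\<lambda>x. x powr c) has_real_derivative c * tpow (c - 1) x) (at x)"
    using True by (auto intro!: derivative_eq_intros simp: tpow_def)
  thus ?thesis
    by (rule has_field_derivative_transform_within_open[of _ _ _ "{0<..}"]) (use True in \<open>auto simp: tpow_def\<close>)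
next
  case False
  have "((\<lambda>x. 0) has_real_derivative c * tpow (c - 1) x) (at x)"
    using False by (auto intro!: derivative_eq_intros simp: tpow_def)
  thus ?thesis
    by (rule has_field_derivative_transform_within_open[of _ _ _ "{..<0}"]) (use assms False in \<open>auto simp: tpow_def\<close>)
qed

text \<open>For \<open>c < 1\<close> the integrand is unbounded to the right of \<open>s\<close>.
  The fundamental theorem still applies, since the antiderivative is continuous everywhere and
  differentiable off the single point \<open>s\<close>.\<close>

lemma tpow_integral:
  assumes "c > 0" "a \<le> b"
  shows "set_integrable lborel {a..b} (\<lambda>z. c * tpow (c - 1) (z - s))"
    "(LINT z:{a..b}|lborel. c * tpow (c - 1) (z - s)) = tpow c (b - s) - tpow c (a - s)"
proof -
  have cont: "isCont (\<lambda>z. tpow c (z - s)) z" for z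
    by (rule isCont_o2[where g = "tpow c"]) (auto intro!: isCont_tpow assms)
  have "((\<lambda>z. c * tpow (c - 1) (z - s)) has_integral tpow c (b - s) - tpow c (a - s)) {a..b}"
  proof (rule fundamental_theorem_of_calculus_interior_strong[of "{s}"])
    fix z assume "z \<in> {a<..<b} - {s}"
    hence "((\<lambda>z. tpow c (z - s)) has_real_derivative c * tpow (c - 1) (z - s) * 1) (at z)"
      by (intro DERIV_chain2[OF tpow_deriv]) (auto intro!: derivative_eq_intros)
    thus "((\<lambda>z. tpow c (z - s)) has_vector_derivative c * tpow (c - 1) (z - s)) (at z)"
      by (simp add: has_real_derivative_iff_has_vector_derivative)
  qed (use assms cont in \<open>auto intro!: continuous_at_imp_continuous_on\<close>)
  moreover have "(\<lambda>z. c * tpow (c - 1) (z - s)) \<in> borel_measurable borel" by measurable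
  ultimately show "set_integrable lborel {a..b} (\<lambda>z. c * tpow (c - 1) (z - s))"
    "(LINT z:{a..b}|lborel. c * tpow (c - 1) (z - s)) = tpow c (b - s) - tpow c (a - s)"
    using assms nonneg_has_integral_lborel[of "\<lambda>z. c * tpow (c - 1) (z - s)" "{a..b}"] by auto
qed

text \<open>The matrix is a 0-1 staircase: its first column vanishes, or its first two rows consist
  of ones, or its first column is the first unit vector and can be expanded. Exponent 0 is a
  separate base case because its column differences are not integrals of a truncated power.\<close>

lemma tpow_zero_kernel:
  assumes "\<And>i j. i < j \<Longrightarrow> j < m \<Longrightarrow> xs i < xs j" "\<And>i j. i < j \<Longrightarrow> j < m \<Longrightarrow> ys i < ys j"
  shows "kdet m (\<lambda>i j. tpow 0 (ys j - xs i)) \<ge> 0"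
  using assms
proof (induction m arbitrary: xs ys)
  case 0
  thus ?case by (simp add: kdet_leibniz)
next
  case (Suc m)
  let ?F = "\<lambda>i j. tpow 0 (ys j - xs i)"
  have xs0: "xs 0 \<le> xs i" and ys0: "ys 0 \<le> ys i" if "i < Suc m" for i
    using Suc.prems that by (cases i; auto simp: less_imp_le)+
  consider "ys 0 \<le> xs 0" | "m > 0" "ys 0 > xs 1" | "xs 0 < ys 0" "m = 0 \<or> ys 0 \<le> xs 1" 
    by linarith
  thus ?case
  proof cases
    case 1
    have "kdet (Suc m) ?F = 0"
    proof (intro kdet_zero_col[of 0])
      show "?F i 0 = 0" if "i < Suc m" for i using xs0[OF that] 1 by (simp add: tpow_def)
    qed simp
    thus ?thesis by simp
  next
    case 2
    hence "xs 0 < xs 1" using Suc.prems(1)[of 0 1] by simp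
    have "kdet (Suc m) ?F = 0"
    proof (intro kdet_equal_rows[of 0 _ 1])
      show "?F 0 j = ?F 1 j" if "j < Suc m" for j
        using ys0[OF that] 2 \<open>xs 0 < xs 1\<close> by (simp add: tpow_def)
    qed (use 2 in auto)
    thus ?thesis by simp
  next
    case 3
    have "tpow 0 (ys 0 - xs (Suc i)) = 0" if "i < m" for i
    proof -
      have "xs 1 \<le> xs (Suc i)" using Suc.prems(1)[of 1 "Suc i"] that by (cases i) auto
      thus ?thesis using 3 that by (auto simp: tpow_def)
    qed
    hence "kdet (Suc m) ?F = ?F 0 0 * kdet m (\<lambda>i j. ?F (Suc i) (Suc j))"
      by (rule kdet_first_col_unit)
    also have "\<dots> \<ge> 0"
      using Suc.prems by (intro mult_nonneg_nonneg Suc.IH) auto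
    finally show ?thesis .
  qed
qed

text \<open>Dividing by the first row and substituting \<open>y \<mapsto> - 1 / (y - x\<^sub>0)\<close> makes the first row constant;
  the column differences are then integrals of the kernel of exponent \<open>c - 1\<close>.\<close>

lemma tpow_kernel:
  assumes "\<And>i j. i < j \<Longrightarrow> j < m \<Longrightarrow> xs i < xs j" "\<And>i j. i < j \<Longrightarrow> j < m \<Longrightarrow> ys i < ys j"
    and "c \<in> \<nat> \<or> c > real m - 2"
  shows "kdet m (\<lambda>i j. tpow c (ys j - xs i)) \<ge> 0"
  using assms
proof (induction m arbitrary: xs ys c)
  case 0
  thus ?case by (simp add: kdet_leibniz)
next
  case (Suc m)
  let ?F = "\<lambda>i j. tpow c (ys j - xs i)"
  have xs0: "xs 0 \<le> xs i" and ys0: "ys 0 \<le> ys i" if "i < Suc m" for i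
    using Suc.prems that by (cases i; auto simp: less_imp_le)+
  consider "m = 0" | "c = 0" | "m > 0" "c \<noteq> 0" "ys 0 \<le> xs 0" | "m > 0" "c \<noteq> 0" "xs 0 < ys 0"
    by linarith
  thus ?case
  proof cases
    case 1
    have "kdet (Suc m) ?F = ?F 0 0 * kdet m (\<lambda>i j. ?F (Suc i) (Suc j))"
      by (rule kdet_first_col_unit) (simp add: 1)
    thus ?thesis using 1 by (simp add: kdet_leibniz)
  next
    case 2
    thus ?thesis using Suc.prems by (simp add: tpow_zero_kernel)
  next
    case 3
    have "kdet (Suc m) ?F = 0"
    proof (intro kdet_zero_col[of 0])
      show "?F i 0 = 0" if "i < Suc m" for i using xs0[OF that] 3 by (simp add: tpow_def)
    qed simp
    thus ?thesis by simp
  next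
    case 4
    \<comment> \<open>For \<open>c\<close> outside the naturals, the bound at order
      \<open>Suc m\<close> reads \<open>c > real m - 1\<close>, and here
      \<open>m > 0\<close>.\<close>
    have c: "c > 0" using Suc.prems(3) 4 by (auto elim!: Nats_cases)
    \<comment> \<open>Division by zero makes \<open>X 0\<close> equal to 0, which is not a
      transformed point; hence \<open>r\<close> and \<open>H\<close> treat row 0 separately.\<close>
    define X where "X = (\<lambda>i. - 1 / (xs i - xs 0))"
    define Y where "Y = (\<lambda>j. - 1 / (ys j - xs 0))"
    define r where "r = (\<lambda>i. if i = 0 then 1 else (xs i - xs 0) powr c)"
    define H where "H = (\<lambda>i j. if i = 0 then 1 else tpow c (Y j - X i))"
    have Ypos: "ys j - xs 0 > 0" if "j < Suc m" for j using ys0[OF that] 4 by linarith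
    have Xpos: "xs i - xs 0 > 0" if "i < Suc m" "i \<noteq> 0" for i using Suc.prems(1)[of 0 i] that by simp
    have Xmono: "X (Suc i) < X (Suc j)" if "i < j" "j < m" for i j
      using Xpos[of "Suc i"] Xpos[of "Suc j"] Suc.prems(1)[of "Suc i" "Suc j"] that
      by (auto simp: X_def intro!: divide_strict_left_mono)
    have Ymono: "Y i < Y j" if "i < j" "j < Suc m" for i j
      using Ypos[of "i"] Ypos[of "j"] Suc.prems(2)[of i j] that
      by (auto simp: Y_def intro!: divide_strict_left_mono)
    have Ymono': "Y i \<le> Y j" if "i \<le> j" "j < Suc m" for i j
      using Ymono[of i j] that by (cases "i = j") auto
    have F: "?F i j = r i * ((ys j - xs 0) powr c * H i j)" if "i < Suc m" "j < Suc m" for i j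
    proof (cases "i = 0")
      case True
      thus ?thesis using Ypos[OF that(2)] by (simp add: r_def H_def tpow_def)
    next
      case False
      \<comment> \<open>With \<open>a = ys j - xs 0\<close> and \<open>b = xs i - xs 0\<close> the
        right side is \<open>ys j - xs i\<close>. So in the new points the kernel keeps its form, up
        to row and column factors.\<close>
      have *: "a * (b * (- 1 / a - - 1 / b)) = a - b" if "a > 0" "b > 0" for a b :: real
        using that by (simp add: field_simps)
      have "ys j - xs i = (ys j - xs 0) * ((xs i - xs 0) * (Y j - X i))"
        unfolding X_def Y_def *[OF Ypos[OF that(2)] Xpos[OF that(1) False]] by simp
      thus ?thesis using False Xpos[OF that(1) False] Ypos[OF that(2)]
        by (simp only: tpow_mult) (simp add: r_def H_def)
    qed
    have "kdet (Suc m) H = kdet m (\<lambda>i j. H (Suc i) (Suc j) - H (Suc i) j)"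
      by (rule kdet_first_row_ones) (simp add: H_def)
    also have "\<dots> = kdet m (\<lambda>i j. LINT z|lborel. indicator {Y j..Y (Suc j)} z * (c * tpow (c - 1) (z - X (Suc i))))"
    proof (rule kdet_cong)
      fix i j assume "i < m" "j < m"
      have H': "H (Suc i) j = tpow c (Y j - X (Suc i))" for j by (simp add: H_def)
      have "Y j \<le> Y (Suc j)" using \<open>j < m\<close> by (intro Ymono') auto
      from tpow_integral(2)[OF c this, of "X (Suc i)"]
      show "H (Suc i) (Suc j) - H (Suc i) j =
          (LINT z|lborel. indicator {Y j..Y (Suc j)} z * (c * tpow (c - 1) (z - X (Suc i))))"
        unfolding H' set_lebesgue_integral_def real_scaleR_def by (rule sym)
    qed
    \<comment> \<open>\<open>kdet_integral\<close> gives one variable to each row, while the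
      interval of integration depends on the column; hence the transposition.\<close>
    also have "\<dots> = kdet m (\<lambda>j i. LINT z|lborel. indicator {Y j..Y (Suc j)} z * (c * tpow (c - 1) (z - X (Suc i))))"
      by (rule kdet_swap)
    also have "\<dots> = (LINT z|Pi\<^sub>M {0..<m} (\<lambda>_. lborel).
        kdet m (\<lambda>j i. indicator {Y j..Y (Suc j)} (z j) * (c * tpow (c - 1) (z j - X (Suc i)))))"
      using tpow_integral(1)[OF c Ymono', of _ "Suc _"]
      by (intro kdet_integral) (simp add: set_integrable_def)
    also have "\<dots> \<ge> 0"
    proof (intro integral_nonneg_AE AE_I2)
      fix z :: "nat \<Rightarrow> real"
      let ?G = "\<lambda>j i. tpow (c - 1) (z j - X (Suc i))"
      \<comment> \<open>Consecutive intervals share only an endpoint, so the \<open>z j\<close> are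
        weakly increasing. Ties give equal rows; otherwise the induction hypothesis applies, since
        order and exponent both drop by one.\<close>
      have "(\<exists>j<m. z j \<notin> {Y j..Y (Suc j)}) \<or> kdet m ?G \<ge> 0"
      proof (cases "\<forall>j<m. z j \<in> {Y j..Y (Suc j)}")
        case True
        show ?thesis
        proof (cases "inj_on z {..<m}")
          case inj: True
          have z: "z i < z j" if "i < j" "j < m" for i j
          proof -
            have "z i \<le> Y (Suc i)" "Y j \<le> z j" using True that by auto
            moreover have "Y (Suc i) \<le> Y j" using that by (intro Ymono') auto
            ultimately have "z i \<le> z j" by linarith
            moreover have "z i \<noteq> z j" using inj that by (auto dest: inj_onD)
            ultimately show ?thesis by simp
          qed
          have "kdet m (\<lambda>i j. ?G j i) \<ge> 0"
            by (rule Suc.IH) (use Xmono z Suc.prems(3) Nats_diff_one c in auto)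
          thus ?thesis unfolding kdet_swap[of m ?G] by simp
        next
          case False
          then obtain i k where "i < m" "k < m" "i \<noteq> k" "z i = z k" by (auto simp: inj_on_def)
          hence "kdet m ?G = 0" by (intro kdet_equal_rows[of i m k]) auto
          thus ?thesis by simp
        qed
      qed auto
      thus "0 \<le> kdet m (\<lambda>j i. indicator {Y j..Y (Suc j)} (z j) * (c * ?G j i))"
      proof
        assume "\<exists>j<m. z j \<notin> {Y j..Y (Suc j)}"
        then obtain j where "j < m" "z j \<notin> {Y j..Y (Suc j)}" by blast
        hence p0: "(\<Prod>j<m. indicator {Y j..Y (Suc j)} (z j) :: real) = 0"
          by (intro prod_zero bexI[of _ j]) auto
        show ?thesis unfolding kdet_rows_scale p0 by simp
      next
        assume "kdet m ?G \<ge> 0"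
        thus ?thesis using c unfolding kdet_rows_scale by (intro mult_nonneg_nonneg prod_nonneg) auto
      qed
    qed
    finally have "kdet (Suc m) H \<ge> 0" .
    moreover have "kdet (Suc m) ?F = (\<Prod>i<Suc m. r i) * ((\<Prod>j<Suc m. (ys j - xs 0) powr c) * kdet (Suc m) H)"
      by (subst kdet_cong[OF F]) (simp_all only: kdet_rows_scale kdet_cols_scale)
    moreover have "r i \<ge> 0" for i by (simp add: r_def)
    ultimately show ?thesis by (simp add: prod_nonneg)
  qed
qed

lemma TP_tpow:
  assumes "c \<in> \<nat> \<or> c > real n - 2"
  shows "TP n I J (\<lambda>x y. tpow c (y - x))"
  by (intro TP_I tpow_kernel) (use assms in auto)

text \<open>With N = k + 1, exp(-t/x) is the limit of (1 - t/(N x))^N. Truncated at 0, this power is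
  (N x)^(-N) times a truncated power of N x - t with natural exponent, hence totally positive of
  every order.\<close>

lemma TP_exp_kernel: "TP n {0<..} {0<..} (\<lambda>t x. exp (- t / x))"
proof (rule TP_limit)
  define K :: "nat \<Rightarrow> real \<Rightarrow> real \<Rightarrow> real" where
    "K = (\<lambda>k t x. 1 * ((real (Suc k) * x) powr (- real (Suc k))) * tpow (real (Suc k)) (real (Suc k) * x - t))"
  show "TP n {0<..} {0<..} (K k)" for k
    unfolding K_def
    by (intro TP_scale TP_reparam[OF TP_tpow, where I = UNIV and J = UNIV])
       (auto simp: strict_mono_on_def)
  show "(\<lambda>k. K k t x) \<longlonglongrightarrow> exp (- t / x)" if "t \<in> {0<..}" "x \<in> {0<..}" for t x
  proof -
    have "(\<lambda>k. (1 + (- t / x) / real (Suc k)) ^ Suc k) \<longlonglongrightarrow> exp (- t / x)"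
      using LIMSEQ_Suc[OF tendsto_exp_limit_sequentially[of "- t / x"]] by simp
    \<comment> \<open>Once N exceeds t/x the base is positive and the truncation has no
      effect.\<close>
    moreover have "eventually (\<lambda>k. (1 + (- t / x) / real (Suc k)) ^ Suc k = K k t x) sequentially"
      using eventually_gt_at_top[of "nat \<lceil>t / x\<rceil>"]
    proof eventually_elim
      case (elim k)
      hence "real (Suc k) > t / x" by linarith
      hence pos: "real (Suc k) * x - t > 0" using that by (simp add: field_simps)
      have "1 + (- t / x) / c = (c * x - t) / (c * x)" if "c > 0" for c
        using that \<open>x \<in> {0<..}\<close> by (simp add: field_simps)
      from this[of "real (Suc k)"]
      have "1 + (- t / x) / real (Suc k) = (real (Suc k) * x - t) / (real (Suc k) * x)"
        by simp
      hence eq: "(1 + (- t / x) / real (Suc k)) ^ Suc k = (real (Suc k) * x - t) ^ Suc k / (real (Suc k) * x) ^ Suc k"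
        by (simp only: power_divide)
      have "real (Suc k) * x > 0" using that by simp
      hence "(real (Suc k) * x) powr (- real (Suc k)) = 1 / (real (Suc k) * x) ^ Suc k"
        by (simp only: powr_minus_divide powr_realpow)
      moreover have "tpow (real (Suc k)) (real (Suc k) * x - t) = (real (Suc k) * x - t) ^ Suc k"
        using pos by (simp only: tpow_def powr_realpow if_True)
      ultimately show ?case
        by (simp only: K_def eq mult_1 times_divide_eq_left)
    qed
    ultimately show ?thesis by (rule Lim_transform_eventually)
  qed
qed

section \<open>Integrals\<close>

lemma power_le_fact_exp:
  fixes x :: real assumes "x \<ge> 0" shows "x ^ k \<le> fact k * exp x"
proof -
  have "(\<Sum>n\<in>{k}. inverse (fact n) * x ^ n) \<le> (\<Sum>n. inverse (fact n) * x ^ n)"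
    using assms by (intro sum_le_suminf summable_exp) auto
  also have "\<dots> = exp x" by (simp add: exp_def field_simps)
  finally show ?thesis by (simp add: field_simps)
qed

text \<open>Dominated convergence along sequences: on the convex ray beyond \<open>l\<close> the
  mean value inequality turns the bound on the derivative into one on difference quotients.
  \<open>D y\<close> is measurable as their pointwise limit.\<close>

lemma has_real_derivative_integral:
  fixes F D :: "real \<Rightarrow> 'a \<Rightarrow> real"
  assumes int: "\<And>y. y > l \<Longrightarrow> integrable M (F y)"
    and der: "\<And>x y. y > l \<Longrightarrow> ((\<lambda>y. F y x) has_real_derivative D y x) (at y)"
    and bound: "\<And>x y. y > l \<Longrightarrow> \<bar>D y x\<bar> \<le> G x" and G: "integrable M G" and y: "y > l"
  shows "((\<lambda>y. LINT x|M. F y x) has_real_derivative (LINT x|M. D y x)) (at y)"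
  unfolding has_field_derivative_iff tendsto_at_iff_sequentially
proof (intro allI impI)
  fix X :: "nat \<Rightarrow> real" assume "\<forall>i. X i \<in> UNIV - {y}" and X: "X \<longlonglongrightarrow> y"
  hence Xne: "X i \<noteq> y" for i by auto
  from X y have "eventually (\<lambda>i. X i > l) sequentially" by (rule order_tendstoD)
  then obtain N where N: "\<And>i. i \<ge> N \<Longrightarrow> X i > l" by (auto simp: eventually_at_top_linorder)
  let ?s = "\<lambda>i x. (F (X (i + N)) x - F y x) / (X (i + N) - y)"
  have XN: "X (i + N) > l" for i by (rule N) simp
  have lim: "(\<lambda>i. ?s i x) \<longlonglongrightarrow> D y x" for x
    using der[OF y, of x] LIMSEQ_ignore_initial_segment[OF X, of N] Xne
    unfolding has_field_derivative_iff tendsto_at_iff_sequentially by (auto simp: comp_def)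
  have si: "integrable M (?s i)" for i using int[OF XN] int[OF y] by auto
  have meas: "D y \<in> borel_measurable M"
    by (rule borel_measurable_LIMSEQ_real[OF lim]) (use si in auto)
  have "(\<lambda>i. LINT x|M. ?s i x) \<longlonglongrightarrow> (LINT x|M. D y x)"
  proof (rule integral_dominated_convergence[OF meas _ G])
    show "AE x in M. norm (?s i x) \<le> G x" for i
    proof (rule AE_I2)
      fix x
      have "norm (F (X (i + N)) x - F y x) \<le> G x * norm (X (i + N) - y)"
      proof (rule field_differentiable_bound[of "{l<..}" "\<lambda>y. F y x" "\<lambda>y. D y x"])
        show "((\<lambda>y. F y x) has_real_derivative D z x) (at z within {l<..})" if "z \<in> {l<..}" for z
          using der[of z x] that has_field_derivative_at_within by auto
      qed (use bound XN y in auto)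
      thus "norm (?s i x) \<le> G x" using Xne[of "i + N"] by (simp add: divide_le_eq abs_mult)
    qed
  qed (use si lim in auto)
  moreover have "(LINT x|M. ?s i x) = ((LINT x|M. F (X (i + N)) x) - (LINT x|M. F y x)) / (X (i + N) - y)" for i
    using int[OF XN] int[OF y] by simp
  ultimately have "(\<lambda>i. ((LINT x|M. F (X (i + N)) x) - (LINT x|M. F y x)) / (X (i + N) - y)) \<longlonglongrightarrow> (LINT x|M. D y x)"
    by (simp only:)
  thus "((\<lambda>z. ((LINT x|M. F z x) - (LINT x|M. F y x)) / (z - y)) \<circ> X) \<longlonglongrightarrow> (LINT x|M. D y x)"
    unfolding comp_def by (rule LIMSEQ_offset)
qed

text \<open>The substitution \<open>v = t + s / q\<close> reduces this to Euler's integral. It is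
  how a power of \<open>q\<close> multiplying exp(-q t) becomes a weighted integral of exp(-q v)
  over later times v.\<close>

lemma gamma_tpow_integral:
  assumes c: "c > -1" and q: "q > 0"
  shows "integrable lborel (\<lambda>v. tpow c (v - t) * exp (- q * v))"
    "(LINT v|lborel. tpow c (v - t) * exp (- q * v)) = Gamma (c + 1) * q powr (- (c + 1)) * exp (- q * t)"
proof -
  let ?f = "\<lambda>v. tpow c (v - t) * exp (- q * v)"
  have G: "((\<lambda>s. s powr c / exp s) has_integral Gamma (c + 1)) {0..}"
    using Gamma_integral_real[of "c + 1"] c by simp
  have eq: "indicator {0..} s *\<^sub>R (s powr c / exp s) = tpow c s * exp (- s)" for s :: real
    by (auto simp: tpow_def indicator_def exp_minus field_simps)
  have T: "integrable lborel (\<lambda>s. tpow c s * exp (- s))" "(LINT s|lborel. tpow c s * exp (- s)) = Gamma (c + 1)"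
    using nonneg_has_integral_lborel[OF _ _ _ G]
    by (simp_all add: set_integrable_def set_lebesgue_integral_def eq del: real_scaleR_def)
  have f: "?f (t + (1 / q) * s) = (q powr (- c) * exp (- q * t)) * (tpow c s * exp (- s))" for s
  proof -
    have "tpow c ((1 / q) * s) = q powr (- c) * tpow c s"
      using q by (subst tpow_mult) (auto simp: powr_divide powr_minus_divide)
    thus ?thesis using q by (simp add: algebra_simps exp_add[symmetric])
  qed
  have "integrable lborel (\<lambda>s. ?f (t + (1 / q) * s))"
    unfolding f by (intro integrable_mult_right T)
  thus "integrable lborel ?f"
    using lborel_integrable_real_affine_iff[of "1 / q" ?f t] q by simp
  have "(LINT v|lborel. ?f v) = \<bar>1 / q\<bar> *\<^sub>R (LINT s|lborel. ?f (t + (1 / q) * s))"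
    using q by (intro lborel_integral_real_affine) auto
  also have "\<dots> = Gamma (c + 1) * (q powr (- c) * (1 / q)) * exp (- q * t)"
    unfolding f using T q by simp
  also have "q powr (- c) * (1 / q) = q powr (- (c + 1))"
    using q powr_add[of q "- c" "- 1"] by (simp add: powr_minus_divide)
  finally show "(LINT v|lborel. ?f v) = Gamma (c + 1) * q powr (- (c + 1)) * exp (- q * t)" .
qed

section \<open>Inversion of the Laplace transform\<close>

lemma erlang_integral:
  assumes "l > 0"
  shows "integrable lborel (erlang_density k l)" "(LINT x|lborel. erlang_density k l x) = 1"
proof -
  have *: "(\<integral>\<^sup>+ x. ennreal (erlang_density k l x) \<partial>lborel) = 1"
    using nn_integral_erlang_ith_moment[OF assms, of k 0] by simp
  have "AE x in lborel. 0 \<le> erlang_density k l x" using assms by auto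
  with * show "integrable lborel (erlang_density k l)" "(LINT x|lborel. erlang_density k l x) = 1"
    by (auto intro!: integrableI_nonneg simp: integral_eq_nn_integral)
qed

text \<open>The function u exp(1 - u) increases up to its strict maximum 1 at u = 1 and then
  decreases, so it is bounded away from 1 outside any neighbourhood of 1. Monotonicity is obtained
  from 1 + y \<le> exp y.\<close>

lemma mult_exp_bound:
  fixes d :: real
  assumes d: "0 < d" "d < 1"
  obtains \<rho> where "0 < \<rho>" "\<rho> < 1" "\<And>u. u > 0 \<Longrightarrow> \<bar>u - 1\<bar> \<ge> d \<Longrightarrow> u * exp (1 - u) \<le> \<rho>"
proof -
  define \<psi> where "\<psi> = (\<lambda>u::real. u * exp (1 - u))"
  have lt: "\<psi> v < 1" if "v > 0" "v \<noteq> 1" for v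
  proof -
    have "ln v < v - 1" using that ln_le_minus_one[of v] ln_eq_minus_one[of v] by fastforce
    hence "exp (ln v + (1 - v)) < exp 0" by (subst exp_less_cancel_iff) simp
    thus ?thesis using that by (simp add: exp_add \<psi>_def)
  qed
  have inc: "\<psi> u \<le> \<psi> v" if "0 < u" "u \<le> v" "v \<le> 1" for u v
  proof -
    have "u / v \<le> 1 - (v - u)"
    proof -
      have "(v - u) * (1 - v) \<ge> 0" using that by simp
      thus ?thesis using that by (simp add: field_simps)
    qed
    also have "\<dots> \<le> exp (- (v - u))" using exp_ge_add_one_self[of "- (v - u)"] by linarith
    finally have "u \<le> v * exp (u - v)" using that by (simp add: field_simps)
    hence "u * exp (1 - u) \<le> v * exp (u - v) * exp (1 - u)" by (intro mult_right_mono) auto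
    thus ?thesis by (simp add: \<psi>_def mult.assoc exp_add[symmetric])
  qed
  have dec: "\<psi> u \<le> \<psi> v" if "1 \<le> v" "v \<le> u" for u v
  proof -
    have "u / v \<le> 1 + (u - v)"
    proof -
      have "(u - v) * (v - 1) \<ge> 0" using that by simp
      thus ?thesis using that by (simp add: field_simps)
    qed
    also have "\<dots> \<le> exp (u - v)" by simp
    finally have "u \<le> v * exp (u - v)" using that by (simp add: field_simps)
    hence "u * exp (1 - u) \<le> v * exp (u - v) * exp (1 - u)" by (intro mult_right_mono) auto
    thus ?thesis by (simp add: \<psi>_def mult.assoc exp_add[symmetric])
  qed
  show thesis
  proof (rule that[of "max (\<psi> (1 - d)) (\<psi> (1 + d))"])
    show "0 < max (\<psi> (1 - d)) (\<psi> (1 + d))" using d by (simp add: \<psi>_def less_max_iff_disj)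
    show "max (\<psi> (1 - d)) (\<psi> (1 + d)) < 1" using d lt by simp
    show "u * exp (1 - u) \<le> max (\<psi> (1 - d)) (\<psi> (1 + d))" if "u > 0" "\<bar>u - 1\<bar> \<ge> d" for u
      using inc[of u "1 - d"] dec[of "1 + d" u] that d by (cases "u \<le> 1") (auto simp: \<psi>_def le_max_iff_disj)
  qed
qed

text \<open>The Erlang densities have mass 1 and concentrate at \<open>x\<close>. Near
  \<open>x\<close> continuity of \<open>f\<close> gives the estimate. Away from \<open>x\<close> the
  densities are at most \<open>c k * \<rho> ^ k\<close>, with \<open>c k\<close> growing at most
  linearly, and integrability of \<open>f\<close> suffices.\<close>

lemma post_widder:
  assumes cont: "continuous_on {0<..} f" and int: "set_integrable lborel {0<..} f" and x: "x > 0"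
  shows "(\<lambda>k. LINT z:{0<..}|lborel. f z * erlang_density (Suc k) (real (Suc k) / x) z) \<longlonglongrightarrow> f x"
proof -
  \<comment> \<open>The rate is chosen so that the density peaks exactly at \<open>x\<close>. Up to
    the constant \<open>c k\<close> it is then the power \<open>Suc k\<close> of
    \<open>\<psi>\<close>, whose maximum 1 is attained at \<open>x\<close>.\<close>
  define w where "w = (\<lambda>k z. erlang_density (Suc k) (real (Suc k) / x) z)"
  define \<psi> where "\<psi> = (\<lambda>z. indicator {0<..} z * (z / x * exp (1 - z / x)))"
  define c where "c = (\<lambda>k. (real (Suc k) / x) * (real (Suc k) ^ Suc k * exp (- real (Suc k)) / fact (Suc k)))"
  define F where "F = (\<lambda>z. indicator {0<..} z * f z)"
  have w: "w k z = c k * \<psi> z ^ Suc k" for k z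
  proof (cases "z > 0")
    case True
    define n where "n = Suc k"
    have E: "exp (- real n) * exp (1 - z / x) ^ n = exp (- (real n / x) * z)"
      by (simp add: exp_of_nat_mult[symmetric] exp_add[symmetric] algebra_simps)
    have "c k * \<psi> z ^ n = (real n / x) * (real n ^ n * (z / x) ^ n * (exp (- real n) * exp (1 - z / x) ^ n)) / fact n"
      using True by (simp only: c_def \<psi>_def n_def[symmetric] power_mult_distrib) simp
    also have "\<dots> = w k z"
      unfolding E w_def n_def[symmetric] using True by (simp add: erlang_density_def power_divide)
    finally show ?thesis by (simp only: n_def)
  qed (auto simp: w_def \<psi>_def erlang_density_def)
  have c: "0 \<le> c k" "c k \<le> real (Suc k) / x" for k
  proof -
    show "0 \<le> c k" using x by (simp add: c_def)
    have "real (Suc k) ^ Suc k * exp (- real (Suc k)) / fact (Suc k) \<le> 1"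
      using power_le_fact_exp[of "real (Suc k)" "Suc k"]
      by (simp add: exp_minus field_simps del: power_Suc fact_Suc of_nat_Suc)
    from mult_left_mono[OF this, of "real (Suc k) / x"] show "c k \<le> real (Suc k) / x"
      using x by (simp add: c_def del: power_Suc fact_Suc of_nat_Suc)
  qed
  have wint: "integrable lborel (w k)" "(LINT z|lborel. w k z) = 1" for k
    unfolding w_def using x by (intro erlang_integral; simp)+
  have w0: "w k z \<ge> 0" for k z using x by (simp add: w_def)
  have \<psi>0: "\<psi> z \<ge> 0" for z using x by (auto simp: \<psi>_def indicator_def)
  have "exp (1 - z / x) = exp 1 * exp (- (1 / x) * z)" for z
    by (simp add: exp_add[symmetric])
  hence "\<psi> = (\<lambda>z. exp 1 * x * erlang_density 1 (1 / x) z)"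
    using x by (auto simp: \<psi>_def erlang_density_def indicator_def fun_eq_iff)
  hence \<psi>int: "integrable lborel \<psi>"
    using erlang_integral(1)[of "1 / x" 1] x by simp
  have Fint: "integrable lborel F" using int by (simp add: set_integrable_def F_def)
  \<comment> \<open>In the far estimate one factor \<open>\<psi>\<close> is kept beside
    \<open>f x\<close>, since the constant alone is not integrable over the half-line.\<close>
  define M where "M = (LINT z|lborel. \<bar>F z\<bar> + \<bar>f x\<bar> * \<psi> z)"
  have Mint: "integrable lborel (\<lambda>z. \<bar>F z\<bar> + \<bar>f x\<bar> * \<psi> z)" using Fint \<psi>int by auto
  have \<psi>1: "\<psi> z \<le> 1" for z
  proof (cases "z > 0")
    case True
    have "z / x \<le> exp (z / x - 1)" using exp_ge_add_one_self[of "z / x - 1"] by simp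
    hence "z / x * exp (1 - z / x) \<le> exp (z / x - 1) * exp (1 - z / x)" by (rule mult_right_mono) simp
    thus ?thesis using True by (simp add: \<psi>_def exp_add[symmetric])
  qed (simp add: \<psi>_def)
  have wb: "w k z \<le> c k" for k z
    using mult_left_mono[OF power_le_one[OF \<psi>0 \<psi>1, of z "Suc k"] c(1)[of k]] by (simp add: w)
  have Fw: "integrable lborel (\<lambda>z. F z * w k z)" for k
  proof (rule Bochner_Integration.integrable_bound)
    show "integrable lborel (\<lambda>z. c k * F z)" using Fint by simp
    show "(\<lambda>z. F z * w k z) \<in> borel_measurable lborel" using Fint wint(1)[of k] by auto
    show "AE z in lborel. norm (F z * w k z) \<le> norm (c k * F z)"
      using wb c w0 by (auto simp: abs_mult mult.commute[of "\<bar>F _\<bar>"] intro!: mult_right_mono)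
  qed
  show ?thesis
  proof (rule LIMSEQ_I)
    fix \<epsilon> :: real assume \<epsilon>: "\<epsilon> > 0"
    have "isCont f x" using cont x by (simp add: continuous_on_eq_continuous_at)
    then obtain \<delta> where \<delta>: "\<delta> > 0" "\<And>z. \<bar>z - x\<bar> < \<delta> \<Longrightarrow> \<bar>f z - f x\<bar> < \<epsilon> / 2"
      using \<epsilon> unfolding continuous_at_eps_delta dist_real_def by (meson half_gt_zero)
    define d where "d = min (\<delta> / x) (1 / 2)"
    have d: "0 < d" "d < 1" using \<delta> x by (auto simp: d_def)
    then obtain \<rho> where \<rho>: "0 < \<rho>" "\<rho> < 1" "\<And>u. u > 0 \<Longrightarrow> \<bar>u - 1\<bar> \<ge> d \<Longrightarrow> u * exp (1 - u) \<le> \<rho>"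
      using mult_exp_bound by blast
    have pw: "\<bar>(F z - f x) * w k z\<bar> \<le> \<epsilon> / 2 * w k z + (c k * \<rho> ^ k) * (\<bar>F z\<bar> + \<bar>f x\<bar> * \<psi> z)" for z k
    proof -
      have E: "(c k * \<rho> ^ k) * (\<bar>F z\<bar> + \<bar>f x\<bar> * \<psi> z) \<ge> 0" using c[of k] \<rho> \<psi>0[of z] by simp
      consider "z \<le> 0" | "z > 0" "\<bar>z - x\<bar> < \<delta>" | "z > 0" "\<bar>z - x\<bar> \<ge> \<delta>" by linarith
      thus ?thesis
      proof cases
        case 1
        hence "w k z = 0" by (simp add: w \<psi>_def)
        thus ?thesis using E by simp
      next
        case 2
        hence "\<bar>F z - f x\<bar> * w k z \<le> \<epsilon> / 2 * w k z"
          using \<delta>(2)[of z] w0[of k z] by (intro mult_right_mono) (auto simp: F_def)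
        thus ?thesis using E w0[of k z] by (simp add: abs_mult)
      next
        case 3
        have "\<bar>z / x - 1\<bar> \<ge> d"
        proof -
          have "z / x - 1 = (z - x) / x" using x by (simp add: diff_divide_distrib)
          hence "\<bar>z / x - 1\<bar> = \<bar>z - x\<bar> / x" using x by (simp add: abs_divide)
          also have "\<dots> \<ge> \<delta> / x" using 3 x by (intro divide_right_mono) auto
          finally show ?thesis by (simp add: d_def)
        qed
        hence "\<psi> z \<le> \<rho>" using 3 x \<rho>(3)[of "z / x"] by (simp add: \<psi>_def)
        hence "\<psi> z ^ k \<le> \<rho> ^ k" using \<psi>0 by (intro power_mono)
        hence "c k * (\<psi> z ^ k * \<psi> z) \<le> c k * (\<rho> ^ k * \<psi> z)"
          using \<psi>0[of z] c(1)[of k] by (intro mult_left_mono mult_right_mono)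
        hence "w k z \<le> c k * \<rho> ^ k * \<psi> z" by (simp add: w mult_ac)
        moreover have "c k * \<rho> ^ k * \<psi> z \<le> c k * \<rho> ^ k"
          using \<psi>1[of z] c(1)[of k] \<rho>(1) by (simp add: mult_left_le)
        ultimately have *: "w k z \<le> c k * \<rho> ^ k * \<psi> z" "w k z \<le> c k * \<rho> ^ k" by auto
        have "\<bar>(F z - f x) * w k z\<bar> \<le> (\<bar>F z\<bar> + \<bar>f x\<bar>) * w k z"
          unfolding abs_mult using w0[of k z] by (intro mult_mono) auto
        also have "\<dots> = \<bar>F z\<bar> * w k z + \<bar>f x\<bar> * w k z" by (simp add: algebra_simps)
        also have "\<dots> \<le> \<bar>F z\<bar> * (c k * \<rho> ^ k) + \<bar>f x\<bar> * (c k * \<rho> ^ k * \<psi> z)"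
          using * by (intro add_mono mult_left_mono) auto
        also have "\<dots> = (c k * \<rho> ^ k) * (\<bar>F z\<bar> + \<bar>f x\<bar> * \<psi> z)" by (simp add: algebra_simps)
        finally show ?thesis using w0[of k z] \<epsilon> by (auto intro: order_trans)
      qed
    qed
    have est: "\<bar>(LINT z|lborel. F z * w k z) - f x\<bar> \<le> \<epsilon> / 2 + (c k * \<rho> ^ k) * M" for k
    proof -
      have "(LINT z|lborel. F z * w k z) - f x = (LINT z|lborel. F z * w k z) - (LINT z|lborel. f x * w k z)"
        using wint by simp
      also have "\<dots> = (LINT z|lborel. (F z - f x) * w k z)"
        using Fw wint by (subst Bochner_Integration.integral_diff[symmetric]) (auto simp: algebra_simps)
      finally have "\<bar>(LINT z|lborel. F z * w k z) - f x\<bar> \<le> (LINT z|lborel. \<bar>(F z - f x) * w k z\<bar>)"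
        using integral_abs_bound[of lborel "\<lambda>z. (F z - f x) * w k z"] by simp
      also have "\<dots> \<le> (LINT z|lborel. \<epsilon> / 2 * w k z + (c k * \<rho> ^ k) * (\<bar>F z\<bar> + \<bar>f x\<bar> * \<psi> z))"
      proof (rule integral_mono)
        have "integrable lborel (\<lambda>z. F z * w k z - f x * w k z)" using Fw wint by auto
        thus "integrable lborel (\<lambda>z. \<bar>(F z - f x) * w k z\<bar>)" by (simp add: algebra_simps)
        show "integrable lborel (\<lambda>z. \<epsilon> / 2 * w k z + (c k * \<rho> ^ k) * (\<bar>F z\<bar> + \<bar>f x\<bar> * \<psi> z))"
          using wint(1)[of k] Fint \<psi>int by auto
      qed (rule pw)
      also have "\<dots> = (LINT z|lborel. \<epsilon> / 2 * w k z) + (LINT z|lborel. (c k * \<rho> ^ k) * (\<bar>F z\<bar> + \<bar>f x\<bar> * \<psi> z))"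
        using wint(1)[of k] Fint \<psi>int by (intro Bochner_Integration.integral_add) auto
      also have "\<dots> = \<epsilon> / 2 + (c k * \<rho> ^ k) * M"
        using wint by (simp only: integral_mult_right_zero M_def mult_1_right)
      finally show ?thesis .
    qed
    have "(\<lambda>k. (c k * \<rho> ^ k) * M) \<longlonglongrightarrow> 0"
    proof (rule tendsto_mult_left_zero, rule tendsto_sandwich[where f = "\<lambda>_. 0" and h = "\<lambda>k. real (Suc k) / x * \<rho> ^ k"])
      have "(\<lambda>k. real k * \<rho> ^ k + \<rho> ^ k) \<longlonglongrightarrow> 0 + 0"
        using \<rho> by (intro tendsto_add powser_times_n_limit_0 LIMSEQ_power_zero) auto
      hence "(\<lambda>k. (real k * \<rho> ^ k + \<rho> ^ k) * (1 / x)) \<longlonglongrightarrow> 0"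
        by (intro tendsto_mult_left_zero) simp
      thus "(\<lambda>k. real (Suc k) / x * \<rho> ^ k) \<longlonglongrightarrow> 0" by (simp add: algebra_simps add_divide_distrib)
      show "eventually (\<lambda>k. 0 \<le> c k * \<rho> ^ k) sequentially" using c \<rho> by auto
      show "eventually (\<lambda>k. c k * \<rho> ^ k \<le> real (Suc k) / x * \<rho> ^ k) sequentially"
        using c \<rho> by (intro always_eventually allI mult_right_mono) auto
    qed auto
    from order_tendstoD(2)[OF this, of "\<epsilon> / 2"] \<epsilon>
    obtain N where N: "\<And>k. k \<ge> N \<Longrightarrow> (c k * \<rho> ^ k) * M < \<epsilon> / 2"
      by (auto simp: eventually_at_top_linorder)
    have "norm ((LINT z:{0<..}|lborel. f z * erlang_density (Suc k) (real (Suc k) / x) z) - f x) < \<epsilon>" if "k \<ge> N" for k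
      using est[of k] N[OF that] by (simp add: set_lebesgue_integral_def F_def w_def mult.assoc)
    thus "\<exists>N. \<forall>k\<ge>N. norm ((LINT z:{0<..}|lborel. f z * erlang_density (Suc k) (real (Suc k) / x) z) - f x) < \<epsilon>"
      by blast
  qed
qed

section \<open>The stable semigroup\<close>

locale positive_stable =
  fixes \<alpha> :: real and p :: "real \<Rightarrow> real \<Rightarrow> real"
  assumes \<alpha>: "0 < \<alpha>" "\<alpha> < 1" and p: "stable_semigroup \<alpha> p"
begin

text \<open>This is (-1)^k times the k-th derivative of the Laplace transform of \<open>p t\<close>
  at \<open>l\<close>; the sign makes it nonnegative.\<close>

definition L :: "nat \<Rightarrow> real \<Rightarrow> real \<Rightarrow> real" where
  "L k t l = (LINT z:{0<..}|lborel. p t z * (z ^ k * exp (- l * z)))"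

lemma p_nonneg: "t > 0 \<Longrightarrow> x > 0 \<Longrightarrow> p t x \<ge> 0"
  and p_cont: "t > 0 \<Longrightarrow> continuous_on {0<..} (p t)"
  and p_int: "t > 0 \<Longrightarrow> set_integrable lborel {0<..} (p t)"
  using p by (auto simp: stable_semigroup_def)

lemma L_0: "t > 0 \<Longrightarrow> l > 0 \<Longrightarrow> L 0 t l = exp (- t * l powr \<alpha>)"
  using p by (auto simp: stable_semigroup_def L_def)

lemma power_exp_le:
  fixes z l :: real
  assumes "z \<ge> 0" "l > 0"
  shows "z ^ k * exp (- l * z) \<le> fact k / (l / 2) ^ k * exp (- (l / 2) * z)"
proof -
  have "(l / 2 * z) ^ k \<le> fact k * exp (l / 2 * z)"
    using assms by (intro power_le_fact_exp) auto
  hence "(l / 2 * z) ^ k * exp (- l * z) \<le> fact k * exp (l / 2 * z) * exp (- l * z)"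
    by (rule mult_right_mono) simp
  also have "\<dots> = fact k * exp (- (l / 2) * z)"
    by (simp add: mult.assoc exp_add[symmetric])
  finally show ?thesis using assms by (simp add: power_mult_distrib field_simps)
qed

lemma L_integrable:
  assumes "t > 0" "l > 0"
  shows "integrable lborel (\<lambda>z. indicator {0<..} z * (p t z * (z ^ k * exp (- l * z))))"
proof (rule Bochner_Integration.integrable_bound)
  define C where "C = fact k / (l / 2) ^ k"
  have C: "C \<ge> 0" using assms by (simp add: C_def)
  have i: "integrable lborel (\<lambda>z. indicator {0<..} z * p t z)"
    using p_int[OF assms(1)] by (simp add: set_integrable_def)
  show "integrable lborel (\<lambda>z. C * (indicator {0<..} z * p t z))" using i by simp
  have "(\<lambda>z. (indicator {0<..} z * p t z) * (z ^ k * exp (- l * z))) \<in> borel_measurable lborel"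
    by (rule borel_measurable_times[OF borel_measurable_integrable[OF i]]) measurable
  thus "(\<lambda>z. indicator {0<..} z * (p t z * (z ^ k * exp (- l * z)))) \<in> borel_measurable lborel"
    by (simp add: mult.assoc)
  have E: "z ^ k * exp (- l * z) \<le> C" if "z > 0" for z
  proof -
    have "z ^ k * exp (- l * z) \<le> C * exp (- (l / 2) * z)"
      unfolding C_def by (rule power_exp_le) (use that assms in auto)
    also have "\<dots> \<le> C * 1" using that assms C by (intro mult_left_mono) auto
    finally show ?thesis by simp
  qed
  show "AE z in lborel. norm (indicator {0<..} z * (p t z * (z ^ k * exp (- l * z)))) \<le> norm (C * (indicator {0<..} z * p t z))"
  proof (rule AE_I2)
    fix z
    show "norm (indicator {0<..} z * (p t z * (z ^ k * exp (- l * z)))) \<le> norm (C * (indicator {0<..} z * p t z))"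
    proof (cases "z > 0")
      case True
      have "p t z * (z ^ k * exp (- l * z)) \<le> p t z * C"
        using p_nonneg[OF assms(1) True] E[OF True] by (rule mult_left_mono[rotated])
      thus ?thesis using p_nonneg[OF assms(1) True] C True by (simp add: abs_mult mult.commute)
    qed simp
  qed
qed

lemma L_eq: "L k t l = (LINT z|lborel. indicator {0<..} z * (p t z * (z ^ k * exp (- l * z))))"
  by (simp add: L_def set_lebesgue_integral_def)

lemma L_nonneg: "t > 0 \<Longrightarrow> L k t l \<ge> 0"
  unfolding L_eq by (rule integral_nonneg_AE) (auto simp: indicator_def p_nonneg)

lemma L_antimono:
  assumes "t > 0" "0 < l" "l \<le> l'"
  shows "L k t l' \<le> L k t l"
  unfolding L_eq
proof (rule integral_mono)
  show "indicator {0<..} z * (p t z * (z ^ k * exp (- l' * z)))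
      \<le> indicator {0<..} z * (p t z * (z ^ k * exp (- l * z)))" for z
    using assms p_nonneg by (auto simp: indicator_def intro!: mult_left_mono mult_right_mono)
qed (use assms L_integrable in auto)

text \<open>Half of the exponent absorbs the power of \<open>z\<close>; the other half leaves
  \<open>L 0 t (l / 2)\<close>, which is explicit. The resulting exponential decay in
  \<open>t\<close> makes integrals over later times converge.\<close>

lemma L_bound:
  assumes "t > 0" "l > 0"
  shows "L k t l \<le> fact k / (l / 2) ^ k * exp (- ((l / 2) powr \<alpha>) * t)"
proof -
  have "L k t l \<le> (LINT z|lborel. fact k / (l / 2) ^ k * (indicator {0<..} z * (p t z * (z ^ 0 * exp (- (l / 2) * z)))))"
    unfolding L_eq
  proof (rule integral_mono)
    show "indicator {0<..} z * (p t z * (z ^ k * exp (- l * z)))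
        \<le> fact k / (l / 2) ^ k * (indicator {0<..} z * (p t z * (z ^ 0 * exp (- (l / 2) * z))))" for z
      using mult_left_mono[OF power_exp_le[of z l k] p_nonneg[of t z]] assms
      by (auto simp: indicator_def mult_ac)
  qed (use assms L_integrable[of t l k] L_integrable[of t "l / 2" 0] in \<open>auto intro!: integrable_mult_right\<close>)
  also have "\<dots> = fact k / (l / 2) ^ k * L 0 t (l / 2)"
    unfolding L_eq by (rule integral_mult_right_zero)
  also have "L 0 t (l / 2) = exp (- ((l / 2) powr \<alpha>) * t)"
    using assms by (simp add: L_0 mult.commute)
  finally show ?thesis .
qed

lemma L_deriv:
  assumes "t > 0" "l > 0"
  shows "(L k t has_real_derivative - L (Suc k) t l) (at l)"
proof -
  \<comment> \<open>On the ray beyond \<open>l / 2\<close> the integrand of \<open>L (Suc k)\<close>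
    is dominated by its value at \<open>l0\<close>, uniformly in \<open>y\<close>.\<close>
  define l0 where "l0 = l / 2"
  have l0: "l0 > 0" "l > l0" using assms by (auto simp: l0_def)
  let ?F = "\<lambda>k y z. indicator {0<..} z * (p t z * (z ^ k * exp (- y * z)))"
  have "((\<lambda>y. LINT z|lborel. ?F k y z) has_real_derivative (LINT z|lborel. - ?F (Suc k) l z)) (at l)"
  proof (rule has_real_derivative_integral[where G = "?F (Suc k) l0" and F = "?F k" and l = l0])
    show "((\<lambda>y. ?F k y z) has_real_derivative - ?F (Suc k) y z) (at y)" for y z
      by (auto intro!: derivative_eq_intros)
    show "\<bar>- ?F (Suc k) y z\<bar> \<le> ?F (Suc k) l0 z" if "y > l0" for y z
      using that assms p_nonneg[of t z]
      by (auto simp: indicator_def abs_mult intro!: mult_left_mono mult_right_mono)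
    show "integrable lborel (?F k y)" if "y > l0" for y
      using that l0 by (intro L_integrable assms) simp
    show "integrable lborel (?F (Suc k) l0)"
      by (intro L_integrable assms l0)
  qed (rule l0)
  thus ?thesis unfolding L_eq[abs_def] by simp
qed

lemma L_1:
  assumes "t > 0" "l > 0"
  shows "L 1 t l = \<alpha> * t * l powr (\<alpha> - 1) * exp (- t * l powr \<alpha>)"
proof -
  have "((\<lambda>l. exp (- t * l powr \<alpha>)) has_real_derivative
      exp (- t * l powr \<alpha>) * (- t * (\<alpha> * l powr (\<alpha> - 1)))) (at l)"
    using assms by (auto intro!: derivative_eq_intros)
  hence "(L 0 t has_real_derivative exp (- t * l powr \<alpha>) * (- t * (\<alpha> * l powr (\<alpha> - 1)))) (at l)"
    by (rule has_field_derivative_transform_within_open[of _ _ _ "{0<..}"]) (use assms in \<open>auto simp: L_0\<close>)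
  from DERIV_unique[OF this L_deriv[OF assms]] show ?thesis by (simp add: algebra_simps)
qed

lemma L_2:
  assumes "t > 0" "l > 0"
  shows "L 2 t l = \<alpha>\<^sup>2 * t * l powr (\<alpha> - 2) * exp (- t * l powr \<alpha>) * ((1 / \<alpha> - 1) + t * l powr \<alpha>)"
proof -
  let ?E = "exp (- t * l powr \<alpha>)"
  have "((\<lambda>l. \<alpha> * t * l powr (\<alpha> - 1) * exp (- t * l powr \<alpha>)) has_real_derivative
      \<alpha> * t * (((\<alpha> - 1) * l powr (\<alpha> - 2)) * ?E + l powr (\<alpha> - 1) * (?E * (- t * (\<alpha> * l powr (\<alpha> - 1)))))) (at l)"
    using assms by (auto intro!: derivative_eq_intros simp: algebra_simps)
  hence "(L 1 t has_real_derivative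
      \<alpha> * t * (((\<alpha> - 1) * l powr (\<alpha> - 2)) * ?E + l powr (\<alpha> - 1) * (?E * (- t * (\<alpha> * l powr (\<alpha> - 1)))))) (at l)"
    by (rule has_field_derivative_transform_within_open[of _ _ _ "{0<..}"]) (use assms in \<open>auto simp: L_1 simp del: One_nat_def\<close>)
  from DERIV_unique[OF this L_deriv[OF assms]]
  have *: "L 2 t l = \<alpha> * t * ?E * ((1 - \<alpha>) * l powr (\<alpha> - 2) + \<alpha> * t * (l powr (\<alpha> - 1) * l powr (\<alpha> - 1)))"
    by (simp add: algebra_simps numeral_2_eq_2)
  have e: "l powr (\<alpha> - 1) * l powr (\<alpha> - 1) = l powr (\<alpha> - 2) * l powr \<alpha>"
    by (simp add: powr_add[symmetric])
  show ?thesis unfolding * e using \<alpha> by (simp add: field_simps power2_eq_square)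
qed

text \<open>Measurability in the time variable has to come from the explicit \<open>L 0\<close>:
  each \<open>L (Suc k)\<close> is a pointwise limit of difference quotients of \<open>L k\<close>
  in \<open>l\<close>, taken with reversed sign.\<close>

lemma L_measurable:
  assumes "l > 0"
  shows "(\<lambda>v. indicator {0<..} v * L k v l) \<in> borel_measurable borel"
  using assms
proof (induction k arbitrary: l)
  case 0
  have "(\<lambda>v. indicator {0<..} v * L 0 v l) = (\<lambda>v. indicator {0<..} v * exp (- v * l powr \<alpha>))"
    using 0 by (auto simp: fun_eq_iff indicator_def L_0)
  thus ?case by simp
next
  case (Suc k)
  let ?s = "\<lambda>n v. (indicator {0<..} v * L k v l - indicator {0<..} v * L k v (l + inverse (real (Suc n)))) / inverse (real (Suc n))"
  show ?case
  proof (rule borel_measurable_LIMSEQ_real[where u = ?s])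
    show "?s n \<in> borel_measurable borel" for n
      using Suc.prems by (intro borel_measurable_divide borel_measurable_diff Suc.IH) (auto intro!: add_pos_pos)
    show "(\<lambda>n. ?s n v) \<longlonglongrightarrow> indicator {0<..} v * L (Suc k) v l" for v
    proof (cases "v > 0")
      case True
      have "((\<lambda>h. (L k v (l + h) - L k v l) / h) \<longlongrightarrow> - L (Suc k) v l) (at 0)"
        using L_deriv[OF True Suc.prems] by (simp add: DERIV_def)
      hence "(\<lambda>n. (L k v (l + inverse (real (Suc n))) - L k v l) / inverse (real (Suc n))) \<longlonglongrightarrow> - L (Suc k) v l"
        using LIMSEQ_inverse_real_of_nat unfolding tendsto_at_iff_sequentially
        by (auto simp: comp_def dest!: spec[of _ "\<lambda>n. inverse (real (Suc n))"])
      from tendsto_minus[OF this] show ?thesis using True by (simp add: minus_divide_left)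
    qed auto
  qed
qed

section \<open>The integral identity between successive derivatives\<close>

lemma tpow_L_integrable:
  assumes "t > 0" "l > 0" "c > -1"
  shows "integrable lborel (\<lambda>v. tpow c (v - t) * L k v l)"
proof (rule Bochner_Integration.integrable_bound)
  let ?C = "fact k / (l / 2) ^ k :: real"
  let ?q = "(l / 2) powr \<alpha>"
  have eq: "tpow c (v - t) * L k v l = tpow c (v - t) * (indicator {0<..} v * L k v l)" for v
    using assms by (auto simp: tpow_def indicator_def)
  show "integrable lborel (\<lambda>v. ?C * (tpow c (v - t) * exp (- ?q * v)))"
    using assms by (intro integrable_mult_right gamma_tpow_integral(1)) auto
  show "(\<lambda>v. tpow c (v - t) * L k v l) \<in> borel_measurable lborel"
    unfolding eq using L_measurable[OF assms(2), of k] by measurable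
  show "AE v in lborel. norm (tpow c (v - t) * L k v l) \<le> norm (?C * (tpow c (v - t) * exp (- ?q * v)))"
  proof (rule AE_I2)
    fix v
    show "norm (tpow c (v - t) * L k v l) \<le> norm (?C * (tpow c (v - t) * exp (- ?q * v)))"
    proof (cases "v > t")
      case True
      hence v: "v > 0" using assms by simp
      have "tpow c (v - t) * L k v l \<le> tpow c (v - t) * (?C * exp (- ?q * v))"
        by (intro mult_left_mono L_bound[OF v assms(2)]) simp
      thus ?thesis using assms L_nonneg[OF v] by (simp add: abs_mult mult_ac)
    qed (simp add: tpow_def)
  qed
qed

text \<open>On the level of \<open>p\<close>, this is the identity
  \<open>x p(t,x) = C t \<integral>\<^sub>t\<^sup>\<infinity> (v - t) powr (1 / \<alpha> - 2) p(v,x) dv\<close>.\<close>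

lemma L_Suc:
  assumes "t > 0" "l > 0"
  shows "L (Suc k) t l = \<alpha> / Gamma (1 / \<alpha> - 1) * t * (LINT v|lborel. tpow (1 / \<alpha> - 2) (v - t) * L k v l)"
  using assms(2)
proof (induction k arbitrary: l)
  let ?c = "1 / \<alpha> - 2" and ?C = "\<alpha> / Gamma (1 / \<alpha> - 1)"
  have c: "?c > -1" using \<alpha> by (simp add: field_simps)
  have G: "Gamma (1 / \<alpha> - 1) > 0" using \<alpha> by (intro Gamma_real_pos) (simp add: field_simps)
  {
    case 0
    \<comment> \<open>With \<open>q = l powr \<alpha>\<close> the Gamma integral yields
      q^(-(1/\<alpha> - 1)) = l^(\<alpha> - 1), the power occurring in \<open>L_1\<close>;
      \<open>?C\<close> cancels the Gamma factor.\<close>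
    have "(LINT v|lborel. tpow ?c (v - t) * L 0 v l) = (LINT v|lborel. tpow ?c (v - t) * exp (- (l powr \<alpha>) * v))"
    proof (intro Bochner_Integration.integral_cong refl)
      fix v
      show "tpow ?c (v - t) * L 0 v l = tpow ?c (v - t) * exp (- (l powr \<alpha>) * v)"
        using assms(1) 0 by (cases "v > t") (simp_all add: L_0 mult.commute tpow_def)
    qed
    also have "\<dots> = Gamma (?c + 1) * (l powr \<alpha>) powr (- (?c + 1)) * exp (- (l powr \<alpha>) * t)"
      using 0 c by (intro gamma_tpow_integral) auto
    also have "?c + 1 = 1 / \<alpha> - 1" by simp
    also have "(l powr \<alpha>) powr (- (1 / \<alpha> - 1)) = l powr (\<alpha> - 1)"
    proof -
      have "\<alpha> * (- (1 / \<alpha> - 1)) = \<alpha> - 1" using \<alpha> by (simp add: algebra_simps)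
      thus ?thesis by (simp only: powr_powr)
    qed
    finally show ?case using L_1[OF assms(1) 0] G by (simp add: mult_ac)
  next
    case (Suc k)
    define l0 where "l0 = l / 2"
    have l0: "l0 > 0" "l > l0" using Suc.prems by (auto simp: l0_def)
    let ?w = "\<lambda>v. tpow ?c (v - t)"
    \<comment> \<open>The identity of order \<open>k\<close> is differentiated in \<open>l\<close>:
      both sides turn into minus those of order \<open>Suc k\<close>.\<close>
    have "((\<lambda>y. LINT v|lborel. ?w v * L k v y) has_real_derivative (LINT v|lborel. - (?w v * L (Suc k) v l))) (at l)"
    proof (rule has_real_derivative_integral[where l = l0 and G = "\<lambda>v. ?w v * L (Suc k) v l0"])
      show "((\<lambda>y. ?w v * L k v y) has_real_derivative - (?w v * L (Suc k) v y)) (at y)" if "y > l0" for v y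
      proof (cases "v > t")
        case True
        thus ?thesis using assms that l0
          by (auto intro!: derivative_eq_intros L_deriv)
      qed (simp add: tpow_def)
      show "\<bar>- (?w v * L (Suc k) v y)\<bar> \<le> ?w v * L (Suc k) v l0" if "y > l0" for v y
      proof (cases "v > t")
        case True
        thus ?thesis using assms that l0 L_nonneg[of v "Suc k" y]
          by (auto simp: abs_mult intro!: mult_left_mono L_antimono)
      qed (simp add: tpow_def)
    qed (use l0 assms c tpow_L_integrable in auto)
    hence "((\<lambda>y. ?C * t * (LINT v|lborel. ?w v * L k v y)) has_real_derivative
        ?C * t * (LINT v|lborel. - (?w v * L (Suc k) v l))) (at l)"
      by (rule DERIV_cmult)
    hence "(L (Suc k) t has_real_derivative ?C * t * (LINT v|lborel. - (?w v * L (Suc k) v l))) (at l)"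
      by (rule has_field_derivative_transform_within_open[of _ _ _ "{0<..}"]) (use Suc in auto)
    from DERIV_unique[OF this L_deriv[OF assms(1) Suc.prems]] show ?case by simp
  }
qed

section \<open>Sufficiency: total positivity of the derivatives and of the semigroup\<close>

lemma TP_L:
  assumes "1 / \<alpha> - 2 \<in> \<nat> \<or> 1 / \<alpha> > real n"
  shows "TP n {0<..} {0<..} (\<lambda>t x. L k t (1 / x))"
proof (induction k)
  case 0
  \<comment> \<open>The second variable is \<open>x = 1 / l\<close> because exp(-t l^\<alpha>) has
    the required sign pattern only after the order of \<open>l\<close> is reversed.\<close>
  have "TP n {0<..} {0<..} (\<lambda>t x. exp (- t / x powr \<alpha>))"
    using \<alpha> by (intro TP_reparam[OF TP_exp_kernel, where f = "\<lambda>t. t" and g = "\<lambda>x. x powr \<alpha>"])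
      (auto simp: strict_mono_on_def powr_less_mono2)
  thus ?case
    by (rule TP_cong[THEN iffD1, rotated]) (simp add: L_0 powr_divide)
next
  case (Suc k)
  let ?c = "1 / \<alpha> - 2" and ?C = "\<alpha> / Gamma (1 / \<alpha> - 1)"
  have c: "?c > -1" using \<alpha> by (simp add: field_simps)
  have G: "Gamma (1 / \<alpha> - 1) > 0" using \<alpha> by (intro Gamma_real_pos) (simp add: field_simps)
  have eq: "indicator {0<..} v * (tpow ?c (v - t) * L k v l) = tpow ?c (v - t) * L k v l" if "t > 0" for t v l
    using that by (auto simp: indicator_def tpow_def)
  have "TP n {0<..} {0<..} (\<lambda>t x. LINT v:{0<..}|lborel. tpow ?c (v - t) * L k v (1 / x))"
  proof (rule TP_compose[OF _ Suc.IH])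
    show "TP n {0<..} {0<..} (\<lambda>t v. tpow ?c (v - t))"
      using assms by (intro TP_tpow) auto
    show "set_integrable lborel {0<..} (\<lambda>v. tpow ?c (v - t) * L k v (1 / x))" if "t \<in> {0<..}" "x \<in> {0<..}" for t x
      using tpow_L_integrable[of t "1 / x" ?c k] c that by (simp add: set_integrable_def eq)
  qed
  hence "TP n {0<..} {0<..} (\<lambda>t x. (?C * t) * 1 * (LINT v:{0<..}|lborel. tpow ?c (v - t) * L k v (1 / x)))"
    by (rule TP_scale) (use G \<alpha> in auto)
  thus ?case
    by (rule TP_cong[THEN iffD1, rotated]) (simp add: L_Suc set_lebesgue_integral_def eq)
qed

lemma TP_stable:
  assumes "1 / \<alpha> - 2 \<in> \<nat> \<or> 1 / \<alpha> > real n"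
  shows "TP n {0<..} {0<..} p"
proof (rule TP_limit)
  \<comment> \<open>With rate \<lambda> = (k + 1)/x, the Erlang density is \<lambda>^(k+2) / (k+1)!
    times z^(k+1) exp(-\<lambda> z). Writing \<lambda> as the reciprocal of
    \<open>x / real (Suc k)\<close> gives the increasing reparametrisation that \<open>TP_L\<close>
    needs.\<close>
  let ?K = "\<lambda>k t x. 1 * ((real (Suc k) / x) ^ Suc (Suc k) / fact (Suc k)) * L (Suc k) t (1 / (x / real (Suc k)))"
  show "TP n {0<..} {0<..} (?K k)" for k
    by (intro TP_scale TP_reparam[OF TP_L[OF assms], where f = "\<lambda>t. t" and g = "\<lambda>x. x / real (Suc k)"])
      (auto simp: strict_mono_on_def divide_strict_right_mono)
  show "(\<lambda>k. ?K k t x) \<longlonglongrightarrow> p t x" if "t \<in> {0<..}" "x \<in> {0<..}" for t x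
  proof -
    have "?K k t x = (LINT z:{0<..}|lborel. p t z * erlang_density (Suc k) (real (Suc k) / x) z)" for k
    proof -
      let ?A = "(real (Suc k) / x) ^ Suc (Suc k) / fact (Suc k)"
      have "?K k t x = (LINT z|lborel. ?A * (indicator {0<..} z * (p t z * (z ^ Suc k * exp (- (1 / (x / real (Suc k))) * z)))))"
        unfolding L_eq mult_1 by (rule integral_mult_right_zero[symmetric])
      also have "\<dots> = (LINT z:{0<..}|lborel. p t z * erlang_density (Suc k) (real (Suc k) / x) z)"
        unfolding set_lebesgue_integral_def real_scaleR_def
        by (intro Bochner_Integration.integral_cong refl)
           (auto simp: indicator_def erlang_density_def simp del: power_Suc of_nat_Suc fact_Suc)
      finally show ?thesis .
    qed
    thus ?thesis using post_widder[OF p_cont p_int, of t x] that by (simp only:) simp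
  qed
qed

section \<open>Necessity: the second derivative as a totally positive kernel\<close>

lemma TP_second_derivative_kernel:
  assumes "TP n {0<..} {0<..} p"
  shows "TP n {0<..} {0<..} (\<lambda>t x. exp (- t / x) * ((1 / \<alpha> - 1) + t / x))"
proof -
  have "TP n {0<..} {0<..} (\<lambda>z x. z ^ 2 * 1 * exp (- z / x))"
    by (intro TP_scale TP_exp_kernel) auto
  hence "TP n {0<..} {0<..} (\<lambda>z x. z ^ 2 * exp (- (1 / x) * z))" by simp
  from TP_compose[OF assms this] have "TP n {0<..} {0<..} (\<lambda>t x. L 2 t (1 / x))"
    using L_integrable[of _ "1 / _" 2] by (simp add: set_integrable_def L_def)
  \<comment> \<open>These factors cancel \<alpha>^2 t l^(\<alpha> - 2) in \<open>L_2\<close>. What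
    remains depends on t / x^\<alpha> only, and a change of variable then removes the power.\<close>
  hence "TP n {0<..} {0<..} (\<lambda>t x. (1 / t) * ((1 / x) powr (2 - \<alpha>) / \<alpha>\<^sup>2) * L 2 t (1 / x))"
    by (rule TP_scale) auto
  moreover have "(1 / t) * ((1 / x) powr (2 - \<alpha>) / \<alpha>\<^sup>2) * L 2 t (1 / x)
      = exp (- t / x powr \<alpha>) * ((1 / \<alpha> - 1) + t / x powr \<alpha>)" if "t > 0" "x > 0" for t x
  proof -
    have "(1 / x) powr (2 - \<alpha>) * (1 / x) powr (\<alpha> - 2) = 1"
      using that by (simp add: powr_add[symmetric])
    moreover have "(1 / x) powr \<alpha> = 1 / x powr \<alpha>" using that by (simp add: powr_divide)
    moreover have "(1 / t) * (u / \<alpha>\<^sup>2) * (\<alpha>\<^sup>2 * t * v * E * R) = E * R" if "u * v = 1" for u v E R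
      using that \<alpha> \<open>t > 0\<close> by (simp add: field_simps)
    ultimately show ?thesis using that by (simp add: L_2)
  qed
  ultimately have "TP n {0<..} {0<..} (\<lambda>t x. exp (- t / x powr \<alpha>) * ((1 / \<alpha> - 1) + t / x powr \<alpha>))"
    by (subst (asm) TP_cong) auto
  hence "TP n {0<..} {0<..} (\<lambda>t x. exp (- t / (x powr (1 / \<alpha>)) powr \<alpha>) * ((1 / \<alpha> - 1) + t / (x powr (1 / \<alpha>)) powr \<alpha>))"
    by (rule TP_reparam[where f = "\<lambda>t. t" and g = "\<lambda>x. x powr (1 / \<alpha>)"])
      (use \<alpha> in \<open>auto simp: strict_mono_on_def powr_less_mono2\<close>)
  thus ?thesis
    by (rule TP_cong[THEN iffD1, rotated]) (use \<alpha> in \<open>simp add: powr_powr\<close>)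
qed

end

section \<open>Minors of the second derivative\<close>

lemma kdet_inverse:
  assumes "kdet m V \<noteq> 0"
  obtains W where "\<And>k l. k < m \<Longrightarrow> l < m \<Longrightarrow> (\<Sum>i<m. W k i * V i l) = (if k = l then 1 else 0)"
proof -
  let ?V = "mat m m (\<lambda>(i,j). V i j)"
  have V: "?V \<in> carrier_mat m m" by simp
  define W where "W = (\<lambda>k i. adj_mat ?V $$ (k, i) / kdet m V)"
  have "(\<Sum>i<m. W k i * V i l) = (if k = l then 1 else 0)" if "k < m" "l < m" for k l
  proof -
    have "(\<Sum>i<m. adj_mat ?V $$ (k, i) * V i l) = (adj_mat ?V * ?V) $$ (k, l)"
      using that adj_mat(1)[OF V] by (simp add: scalar_prod_def lessThan_atLeast0)
    also have "\<dots> = (if k = l then kdet m V else 0)"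
      unfolding adj_mat(3)[OF V] kdet_def using that by simp
    finally show ?thesis
      using assms by (simp add: W_def sum_divide_distrib[symmetric])
  qed
  thus thesis by (rule that)
qed

text \<open>The coefficient of u^k is b/k! - 1/(k-1)! = (b - k)/k! for k > 0. The remainder is
  needed with u^m factored out exactly, so \<open>g\<close> is the shifted power series, continuous
  because it converges everywhere.\<close>

lemma exp_kernel_taylor:
  fixes b :: real
  obtains g where "isCont g 0"
    "\<And>u. exp u * (b - u) = (\<Sum>k<m. (b - real k) / fact k * u ^ k) + u ^ m * g u"
proof -
  define a where "a = (\<lambda>k. (b - real k) / fact k)"
  have a: "(\<lambda>k. a k * u ^ k) sums (exp u * (b - u))" for u
  proof -
    have e: "(\<lambda>k. u ^ k / fact k) sums exp u" using exp_converges[of u] by (simp add: field_simps)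
    have "(\<lambda>k. u * (u ^ k / fact k)) sums (u * exp u)" by (intro sums_mult e)
    moreover have "u * (u ^ k / fact k) = real (Suc k) * u ^ Suc k / fact (Suc k)" for k
      by (simp add: fact_Suc del: of_nat_Suc)
    ultimately have "(\<lambda>k. real k * u ^ k / fact k) sums (u * exp u)"
      by (subst sums_Suc_iff[where f = "\<lambda>k. real k * u ^ k / fact k", symmetric, simplified]) simp
    from sums_diff[OF sums_mult[OF e, of b] this] show ?thesis
      by (simp add: a_def algebra_simps diff_divide_distrib)
  qed
  define g where "g = (\<lambda>u. \<Sum>k. a (k + m) * u ^ k)"
  have summ: "summable (\<lambda>k. a (k + m) * u ^ k)" for u
  proof (cases "u = 0")
    case False
    have "summable (\<lambda>k. a (k + m) * u ^ (k + m))"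
      using sums_summable[OF a] by (subst summable_iff_shift)
    hence "summable (\<lambda>k. a (k + m) * u ^ (k + m) / u ^ m)" by (rule summable_divide)
    thus ?thesis using False by (simp add: power_add)
  qed (simp add: summable_0_powser)
  show thesis
  proof (rule that[of g])
    show "isCont g 0" unfolding g_def
      by (rule isCont_powser[OF summ[of 1]]) simp
    show "exp u * (b - u) = (\<Sum>k<m. (b - real k) / fact k * u ^ k) + u ^ m * g u" for u
    proof -
      have "exp u * (b - u) = (\<Sum>k. a k * u ^ k)" using a by (rule sums_unique)
      also have "\<dots> = (\<Sum>k. a (k + m) * u ^ (k + m)) + (\<Sum>k<m. a k * u ^ k)"
        using sums_summable[OF a] by (rule suminf_split_initial_segment)
      also have "(\<Sum>k. a (k + m) * u ^ (k + m)) = u ^ m * g u"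
        unfolding g_def by (subst suminf_mult[OF summ, symmetric]) (simp add: power_add mult_ac)
      finally show ?thesis by (simp add: a_def)
    qed
  qed
qed

text \<open>The factors \<open>b - k\<close> are the Taylor coefficients of \<open>(b - u) exp u\<close>, up to \<open>k!\<close>. Row operations with the
  inverse of a Vandermonde matrix isolate them in a minor as \<open>t \<rightarrow> 0\<close>.\<close>

lemma TP_exp_kernel_coeffs:
  assumes TP: "TP n {0<..} {0<..} (\<lambda>t x. exp (- t / x) * (b + t / x))" and m: "m \<le> n"
  shows "(\<Prod>k<m. b - real k) \<ge> 0"
proof -
  \<comment> \<open>The minor is taken at times \<open>\<epsilon> * real (Suc i)\<close> and points
    \<open>real (Suc j)\<close>, so that u = -t/x equals
    \<open>\<epsilon> * real (Suc i) * s j\<close>. The nodes \<open>s j\<close> increase, which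
    makes their Vandermonde determinant positive at the end.\<close>
  define s where "s = (\<lambda>j. - 1 / real (Suc j))"
  define a where "a = (\<lambda>k. (b - real k) / fact k)"
  let ?V = "\<lambda>i k. real (Suc i) ^ k"
  have V: "kdet m ?V > 0" by (rule vandermonde_pos) simp
  then obtain W where W: "\<And>k l. k < m \<Longrightarrow> l < m \<Longrightarrow> (\<Sum>i<m. W k i * ?V i l) = (if k = l then 1 else 0)"
    using kdet_inverse[of m ?V] by auto
  have detW: "kdet m W > 0"
  proof -
    have "kdet m W * kdet m ?V = kdet m (\<lambda>k l. if k = l then 1 else 0)"
      unfolding kdet_mult[symmetric] by (intro kdet_cong W)
    also have "\<dots> = 1" by (subst kdet_upper_triangular) auto
    finally have "kdet m W * kdet m ?V = 1" .
    hence "kdet m W * kdet m ?V > 0" by (simp only: zero_less_one)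
    thus ?thesis using V by (rule zero_less_mult_pos2)
  qed
  obtain g where g: "isCont g 0"
    "\<And>u. exp u * (b - u) = (\<Sum>k<m. a k * u ^ k) + u ^ m * g u"
    unfolding a_def using exp_kernel_taylor by blast
  define A where "A = (\<lambda>\<epsilon> i j. exp (\<epsilon> * real (Suc i) * s j) * (b - \<epsilon> * real (Suc i) * s j))"
  \<comment> \<open>Row k of the inverse Vandermonde matrix extracts the term of degree k in
    \<epsilon>; dividing by \<open>\<epsilon> ^ k\<close> brings it to size 1. Both operations have
    positive determinant, so the sign of the minor is kept.\<close>
  define B where "B = (\<lambda>\<epsilon> k j. (1 / \<epsilon> ^ k) * (\<Sum>i<m. W k i * A \<epsilon> i j))"
  have B_nonneg: "kdet m (B \<epsilon>) \<ge> 0" if "\<epsilon> > 0" for \<epsilon>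
  proof -
    have "kdet m (\<lambda>i j. exp (- (\<epsilon> * real (Suc i)) / real (Suc j)) * (b + (\<epsilon> * real (Suc i)) / real (Suc j))) \<ge> 0"
      by (rule TP_D[OF TP m]) (use that in auto)
    hence "kdet m (A \<epsilon>) \<ge> 0" by (simp add: A_def s_def)
    thus ?thesis unfolding B_def kdet_rows_scale kdet_mult using that detW
      by (intro mult_nonneg_nonneg prod_nonneg) auto
  qed
  have B_lim: "((\<lambda>\<epsilon>. B \<epsilon> k j) \<longlongrightarrow> a k * s j ^ k) (at_right 0)" if k: "k < m" for k j
  proof -
    \<comment> \<open>Degrees below \<open>m\<close> other than \<open>k\<close> cancel exactly, so
      only the remainder is left; it carries the factor \<open>\<epsilon> ^ (m - k)\<close> with
      \<open>m - k > 0\<close>.\<close>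
    define R where "R = (\<lambda>\<epsilon>. \<Sum>i<m. W k i * (real (Suc i) * s j) ^ m * g (\<epsilon> * (real (Suc i) * s j)))"
    have eq: "B \<epsilon> k j = a k * s j ^ k + \<epsilon> ^ (m - k) * R \<epsilon>" if "\<epsilon> > 0" for \<epsilon>
    proof -
      have "W k i * A \<epsilon> i j = (\<Sum>l<m. a l * (\<epsilon> * s j) ^ l * (W k i * ?V i l)) +
          \<epsilon> ^ m * (W k i * (real (Suc i) * s j) ^ m * g (\<epsilon> * (real (Suc i) * s j)))" for i
        unfolding A_def g(2) by (simp add: sum_distrib_left distrib_left power_mult_distrib mult_ac del: of_nat_Suc)
      hence "(\<Sum>i<m. W k i * A \<epsilon> i j) =
          (\<Sum>i<m. \<Sum>l<m. a l * (\<epsilon> * s j) ^ l * (W k i * ?V i l)) + \<epsilon> ^ m * R \<epsilon>"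
        by (simp only: R_def sum_distrib_left sum.distrib)
      also have "(\<Sum>i<m. \<Sum>l<m. a l * (\<epsilon> * s j) ^ l * (W k i * ?V i l)) =
          (\<Sum>l<m. a l * (\<epsilon> * s j) ^ l * (\<Sum>i<m. W k i * ?V i l))"
        by (subst sum.swap) (simp add: sum_distrib_left)
      also have "\<dots> = (\<Sum>l<m. if k = l then a l * (\<epsilon> * s j) ^ l else 0)"
        using k by (intro sum.cong refl) (simp add: W del: of_nat_Suc)
      also have "\<dots> = a k * (\<epsilon> * s j) ^ k" using k by simp
      finally have "B \<epsilon> k j = (1 / \<epsilon> ^ k) * (a k * (\<epsilon> * s j) ^ k + \<epsilon> ^ m * R \<epsilon>)" by (simp add: B_def)
      also have "\<epsilon> ^ m = \<epsilon> ^ k * \<epsilon> ^ (m - k)" using k by (simp add: power_add[symmetric])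
      finally have "\<epsilon> ^ k * B \<epsilon> k j = \<epsilon> ^ k * (a k * s j ^ k + \<epsilon> ^ (m - k) * R \<epsilon>)"
        using that by (simp add: power_mult_distrib field_simps)
      thus ?thesis using that by simp
    qed
    have "((\<lambda>\<epsilon>. g (\<epsilon> * c)) \<longlongrightarrow> g 0) (at_right 0)" for c
    proof (rule isCont_tendsto_compose[OF g(1)])
      have "((\<lambda>\<epsilon>. \<epsilon> * c) \<longlongrightarrow> 0 * c) (at_right 0)" by (intro tendsto_intros)
      thus "((\<lambda>\<epsilon>. \<epsilon> * c) \<longlongrightarrow> 0) (at_right 0)" by simp
    qed
    hence "((\<lambda>\<epsilon>. a k * s j ^ k + \<epsilon> ^ (m - k) * R \<epsilon>) \<longlongrightarrow>
        a k * s j ^ k + 0 ^ (m - k) * (\<Sum>i<m. W k i * (real (Suc i) * s j) ^ m * g 0)) (at_right 0)"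
      unfolding R_def by (intro tendsto_intros)
    hence "((\<lambda>\<epsilon>. a k * s j ^ k + \<epsilon> ^ (m - k) * R \<epsilon>) \<longlongrightarrow> a k * s j ^ k) (at_right 0)"
      using k by (simp add: power_0_left)
    moreover have "eventually (\<lambda>\<epsilon>. a k * s j ^ k + \<epsilon> ^ (m - k) * R \<epsilon> = B \<epsilon> k j) (at_right 0)"
      using eq by (auto simp: eventually_at_filter)
    ultimately show ?thesis by (rule Lim_transform_eventually)
  qed
  have "kdet m (\<lambda>k j. a k * s j ^ k) \<ge> 0"
  proof (rule tendsto_lowerbound)
    show "((\<lambda>\<epsilon>. kdet m (B \<epsilon>)) \<longlongrightarrow> kdet m (\<lambda>k j. a k * s j ^ k)) (at_right 0)"
      by (intro tendsto_kdet B_lim)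
    show "eventually (\<lambda>\<epsilon>. 0 \<le> kdet m (B \<epsilon>)) (at_right 0)"
      using B_nonneg by (auto simp: eventually_at_filter)
  qed simp
  also have "kdet m (\<lambda>k j. a k * s j ^ k) = (\<Prod>k<m. a k) * kdet m (\<lambda>k j. s j ^ k)"
    by (rule kdet_rows_scale)
  also have "kdet m (\<lambda>k j. s j ^ k) = kdet m (\<lambda>j k. s j ^ k)" by (rule kdet_swap)
  finally have "(\<Prod>k<m. a k) * kdet m (\<lambda>j k. s j ^ k) \<ge> 0" .
  moreover have "kdet m (\<lambda>j k. s j ^ k) > 0"
    by (rule vandermonde_pos) (auto simp: s_def field_simps)
  ultimately have "(\<Prod>k<m. a k) \<ge> 0" by (simp add: zero_le_mult_iff)
  moreover have "(\<Prod>k<m. b - real k) = (\<Prod>k<m. a k) * (\<Prod>k<m. fact k)"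
    by (simp add: a_def prod.distrib[symmetric])
  ultimately show ?thesis by (simp add: prod_nonneg)
qed

theorem theorem1:
  fixes \<alpha> :: real and p :: "real \<Rightarrow> real \<Rightarrow> real" and n :: nat
  assumes "0 < \<alpha>" and "\<alpha> < 1"
    and "stable_semigroup \<alpha> p"
    and "n \<ge> 2"
  shows "TP n {0<..} {0<..} p \<longleftrightarrow>
           (\<alpha> \<in> {1 / real k | k. 2 \<le> k \<and> k \<le> n} \<or> \<alpha> < 1 / real n)"
proof
  interpret positive_stable \<alpha> p by unfold_locales fact+
  {
    assume TP: "TP n {0<..} {0<..} p"
    show "\<alpha> \<in> {1 / real k | k. 2 \<le> k \<and> k \<le> n} \<or> \<alpha> < 1 / real n"
    proof (rule ccontr)
      assume neg: "\<not> ?thesis"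
      define a where "a = 1 / \<alpha>"
      have a1: "a > 1" using \<alpha> by (simp add: a_def)
      have an: "a \<le> real n" using neg \<alpha> assms(4) by (simp add: a_def field_simps)
      have nonint: "a \<noteq> real k" for k
      proof
        assume "a = real k"
        moreover have "\<alpha> = 1 / a" by (simp add: a_def)
        ultimately have "\<alpha> = 1 / real k" "2 \<le> k" "k \<le> n" using a1 an by auto
        thus False using neg by blast
      qed
      \<comment> \<open>The order \<open>Suc r\<close> is the least integer above \<open>a\<close>,
        and it is at most \<open>n\<close> because \<open>a \<le> n\<close> is not an integer. In
        the product of that order only the last factor \<open>a - 1 - r\<close> is negative.\<close>
      define r where "r = nat \<lfloor>a\<rfloor>"
      have r: "real r < a" "a < real r + 1" "r < n"
        using a1 an nonint[of r] by (auto simp: r_def) linarith+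
      have "(\<Prod>k<Suc r. (a - 1) - real k) \<ge> 0"
        using TP_exp_kernel_coeffs[OF TP_second_derivative_kernel[OF TP], of "Suc r"] r by (simp add: a_def)
      moreover have "(\<Prod>k<r. (a - 1) - real k) > 0"
        using r by (intro prod_pos) auto
      moreover have "(a - 1) - real r < 0" using r by simp
      ultimately show False by (simp add: zero_le_mult_iff)
    qed
  next
    assume "\<alpha> \<in> {1 / real k | k. 2 \<le> k \<and> k \<le> n} \<or> \<alpha> < 1 / real n"
    thus "TP n {0<..} {0<..} p"
    proof
      assume "\<alpha> \<in> {1 / real k | k. 2 \<le> k \<and> k \<le> n}"
      then obtain k where "\<alpha> = 1 / real k" "k \<ge> 2" by auto
      hence "1 / \<alpha> - 2 = real (k - 2)" by (simp add: of_nat_diff)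
      thus ?thesis by (intro TP_stable) simp
    next
      assume "\<alpha> < 1 / real n"
      thus ?thesis using \<alpha> assms(4) by (intro TP_stable) (simp add: field_simps)
    qed
  }
qed

end
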